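(* Let $1\le m<n$ and $2\le N\le n-m$ be integers, and let $X_{1:n}\le\cdots\le X_{n:n}$ be the order statistics of an i.i.d. sample of size $n$ from the density $\theta e^{-\theta t}\mathbb{I}_{(0,\infty)}(t)$. Let $X=\sum_{i=1}^m X_{i:n}+(n-m)X_{m:n}$ and $Z=(Z_1,\dots,Z_N)$ with $Z_i=X_{m+i:n}-X_{m+i-1:n}$. Put on $\theta$ the prior $\pi_{\alpha,\beta}(\theta)\propto\theta^{\alpha-1}e^{-\beta\theta}\mathbb{I}_{(0,\infty)}(\theta)$, with either $\alpha,\beta>0$ or $\alpha=\beta=0$, and let $\lambda\in(0,1)$. Then for every $x>0$ the HPD prediction region of credibility $1-\lambda$ for $Z$ is $$R_{HPD}(x)=\Big\{z\in\mathbb{R}_+^N:\ \sum_{i=1}^N(n-m-i+1)z_i\le c_0(x+\beta)\Big\},$$ where $c_0$ is the quantile of order $1-\lambda$ of the $B2(N,m+\alpha)$ distribution.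
   Context: The Bayes predictive density of $Z$ given $X=x$ under prior $\pi$ is $\hat q_\pi(z|x)=\int_0^\infty q_\theta(z|x)\,\pi(\theta|x)\,d\theta$, with $q_\theta(\cdot|x)$ the conditional density of $Z$ given $X=x$ under $\theta$ and $\pi(\theta|x)$ the posterior. The HPD region of credibility $1-\lambda$ is $\{z\in\mathbb{R}_+^N:\hat q_\pi(z|x)\ge k\}$ where $k$ is chosen so that $\int_{R}\hat q_\pi(z|x)\,dz=1-\lambda$. The Beta type II distribution $B2(N,a)$ has density $\frac{\Gamma(N+a)}{\Gamma(N)\Gamma(a)}\frac{w^{N-1}}{(1+w)^{N+a}}$ on $(0,\infty)$. *)

theory Defs
  imports "HOL-Probability.Probability"
begin

definition sample_measure :: "nat \<Rightarrow> real \<Rightarrow> (nat \<Rightarrow> real) measure" where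
  "sample_measure n \<theta> = PiM {0..<n} (\<lambda>_. density lborel (exponential_density \<theta>))"

definition order_stat :: "nat \<Rightarrow> (nat \<Rightarrow> real) \<Rightarrow> nat \<Rightarrow> real" where
  "order_stat n \<omega> k = sort (map \<omega> [0..<n]) ! (k - 1)"

definition statX :: "nat \<Rightarrow> nat \<Rightarrow> (nat \<Rightarrow> real) \<Rightarrow> real" where
  "statX n m \<omega> = (\<Sum>i=1..m. order_stat n \<omega> i) + real (n - m) * order_stat n \<omega> m"

definition statZ :: "nat \<Rightarrow> nat \<Rightarrow> nat \<Rightarrow> (nat \<Rightarrow> real) \<Rightarrow> (nat \<Rightarrow> real)" where
  "statZ n m N \<omega> = (\<lambda>i\<in>{1..N}. order_stat n \<omega> (m + i) - order_stat n \<omega> (m + i - 1))"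

definition lebN :: "nat \<Rightarrow> (nat \<Rightarrow> real) measure" where
  "lebN N = PiM {1..N} (\<lambda>_. lborel)"

definition pos_orthant :: "nat \<Rightarrow> (nat \<Rightarrow> real) set" where
  "pos_orthant N = PiE {1..N} (\<lambda>_. {0<..})"

text \<open>q is a conditional density of Z given X (X having density fX) under P:
  the joint density of (X,Z) is fX(x) * q(x,z).  The argument order is q x z.\<close>
definition is_cond_density ::
  "'a measure \<Rightarrow> ('a \<Rightarrow> real) \<Rightarrow> ('a \<Rightarrow> 'b) \<Rightarrow> 'b measure \<Rightarrow> (real \<Rightarrow> real)
     \<Rightarrow> (real \<Rightarrow> 'b \<Rightarrow> real) \<Rightarrow> bool" where
  "is_cond_density P X Z L fX q \<longleftrightarrow>
     (\<forall>x z. 0 \<le> q x z) \<and>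
     distributed P (lborel \<Otimes>\<^sub>M L) (\<lambda>\<omega>. (X \<omega>, Z \<omega>))
        (\<lambda>(x, z). ennreal (fX x * q x z))"

definition gamma_prior :: "real \<Rightarrow> real \<Rightarrow> real \<Rightarrow> real" where
  "gamma_prior \<alpha> \<beta> \<theta> = (if 0 < \<theta> then \<theta> powr (\<alpha> - 1) * exp (- \<beta> * \<theta>) else 0)"

definition posterior :: "(real \<Rightarrow> real) \<Rightarrow> (real \<Rightarrow> real \<Rightarrow> real) \<Rightarrow> real \<Rightarrow> real \<Rightarrow> real" where
  "posterior pr lik x \<theta> = pr \<theta> * lik \<theta> x / (LINT t:{0<..}|lborel. pr t * lik t x)"

definition pred_density ::
  "(real \<Rightarrow> real \<Rightarrow> 'b \<Rightarrow> real) \<Rightarrow> (real \<Rightarrow> real \<Rightarrow> real) \<Rightarrow> real \<Rightarrow> 'b \<Rightarrow> real" where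
  "pred_density q post x z = (LINT \<theta>:{0<..}|lborel. q \<theta> x z * post x \<theta>)"

definition hpd_set :: "nat \<Rightarrow> ((nat \<Rightarrow> real) \<Rightarrow> real) \<Rightarrow> real \<Rightarrow> (nat \<Rightarrow> real) set" where
  "hpd_set N qh k = {z \<in> pos_orthant N. k \<le> qh z}"

definition b2_density :: "real \<Rightarrow> real \<Rightarrow> real \<Rightarrow> real" where
  "b2_density N a w = (if 0 < w then Gamma (N + a) / (Gamma N * Gamma a) * w powr (N - 1)
        / (1 + w) powr (N + a) else 0)"

end

theory Submission
  imports Defs "HOL-Combinatorics.Permutations"
begin

text \<open>
  By Renyi's representation, the order statistics of an exponential sample of size n have the
  joint law of the partial sums of the independent spacings u_j / (n - j), with the u_j again
  exponential of rate \<open>\<theta>\<close>. Hence X is a sum of m of the u_j (Erlang distributed) and is independent of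
  Z, whose components are exponential with rates \<open>\<theta>\<close> (n - m - i + 1). Since the given densities
  are continuous, they agree with these pointwise. Integrating out \<open>\<theta>\<close> against the gamma posterior,
  the predictive density is a strictly decreasing function of the linear form
  s(z) = \<open>\<Sum>\<close> (n - m - i + 1) z_i, and s(Z) / (x + \<open>\<beta>\<close>) has the predictive law B2(N, m + \<open>\<alpha>\<close>). So the HPD sets are
  exactly the sublevel sets of s, and the credibility determines the level.
\<close>

text \<open>The functions \<open>fX\<close> and \<open>q\<close> are given for each \<theta>
  separately, and the laws of the statistics fix them only up to a null set that may vary with
  \<theta>. The predictive density, however, integrates over \<theta> at one fixed x and z, so
  equality almost everywhere says nothing about it; this is why equality is carried to every point
  of the open orthant. Renyi's representation rests on two coincidences. The joint density of an
  exponential sample depends only on the sum of the coordinates, which the map from spacings to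
  ordered values preserves; and the determinant 1/n! of that map is exactly offset by the n!
  orderings of the sample. The level is pinned down by strict growth of the B2 integral, together
  with its finiteness at \<open>c0\<close>, which the quantile equation itself provides.\<close>

section \<open>Products of densities and the substitution by spacings\<close>

lemma PiM_density:
  assumes "finite I" and f: "\<And>i. f i \<in> borel_measurable (M i)"
    and M: "\<And>i. sigma_finite_measure (M i)"
    and D: "\<And>i. sigma_finite_measure (density (M i) (f i))"
  shows "PiM I (\<lambda>i. density (M i) (f i)) = density (PiM I M) (\<lambda>x. \<Prod>i\<in>I. f i (x i))"
proof -
  interpret M: product_sigma_finite M
    using M by unfold_locales (simp add: sigma_finite_measure_def)
  interpret D: product_sigma_finite "\<lambda>i. density (M i) (f i)"
    using D by (simp add: product_sigma_finite_def)
  note f[measurable]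
  show ?thesis
  proof (rule D.PiM_eqI[symmetric])
    show "sets (density (PiM I M) (\<lambda>x. \<Prod>i\<in>I. f i (x i))) = sets (PiM I (\<lambda>i. density (M i) (f i)))"
      by (simp cong: sets_PiM_cong)
    fix A assume A: "\<And>i. i \<in> I \<Longrightarrow> A i \<in> sets (density (M i) (f i))"
    then have [measurable]: "Pi\<^sub>E I A \<in> sets (PiM I M)"
      using \<open>finite I\<close> by (intro sets_PiM_I_finite) auto
    have "emeasure (density (PiM I M) (\<lambda>x. \<Prod>i\<in>I. f i (x i))) (Pi\<^sub>E I A)
        = (\<integral>\<^sup>+x. (\<Prod>i\<in>I. f i (x i)) * indicator (Pi\<^sub>E I A) x \<partial>PiM I M)"
      using \<open>finite I\<close> by (subst emeasure_density) auto
    also have "\<dots> = (\<integral>\<^sup>+x. (\<Prod>i\<in>I. f i (x i) * indicator (A i) (x i)) \<partial>PiM I M)"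
    proof (intro nn_integral_cong)
      fix x assume "x \<in> space (PiM I M)"
      then have "indicator (Pi\<^sub>E I A) x = (\<Prod>i\<in>I. indicator (A i) (x i) :: ennreal)"
        using \<open>finite I\<close>
        by (auto simp: indicator_def space_PiM PiE_iff prod_zero_iff split: if_splits)
      then show "(\<Prod>i\<in>I. f i (x i)) * indicator (Pi\<^sub>E I A) x
          = (\<Prod>i\<in>I. f i (x i) * indicator (A i) (x i))"
        by (simp add: prod.distrib)
    qed
    also have "\<dots> = (\<Prod>i\<in>I. \<integral>\<^sup>+x. f i x * indicator (A i) x \<partial>M i)"
      using \<open>finite I\<close> A by (intro M.product_nn_integral_prod) auto
    also have "\<dots> = (\<Prod>i\<in>I. emeasure (density (M i) (f i)) (A i))"
      using A by (intro prod.cong refl) (simp add: emeasure_density)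
    finally show "emeasure (density (PiM I M) (\<lambda>x. \<Prod>i\<in>I. f i (x i))) (Pi\<^sub>E I A)
        = (\<Prod>i\<in>I. emeasure (density (M i) (f i)) (A i))" .
  qed fact
qed

text \<open>The substitution x_i = w_0 u_0 + ... + w_i u_i is triangular, so its determinant is the
  product of the w_j; the induction performs one affine substitution per coordinate under Tonelli.
  \<open>case_nat 0 x i\<close> stands for x_(i-1) with x_(-1) = 0, so the indicators say that x is
  nonnegative and increasing.\<close>

lemma nn_integral_increasing_spacings:
  fixes w :: "nat \<Rightarrow> real" and F :: "(nat \<Rightarrow> real) \<Rightarrow> ennreal"
  assumes "\<And>j. j < k \<Longrightarrow> 0 < w j"
    and "F \<in> borel_measurable (PiM {0..<k} (\<lambda>_. lborel))"
  shows "(\<integral>\<^sup>+x. F x * (\<Prod>i<k. indicator {0..} (x i - case_nat 0 x i)) \<partial>PiM {0..<k} (\<lambda>_. lborel))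
    = ennreal (\<Prod>j<k. w j) *
      (\<integral>\<^sup>+u. F (\<lambda>i\<in>{0..<k}. \<Sum>j\<le>i. w j * u j) * (\<Prod>j<k. indicator {0..} (u j))
        \<partial>PiM {0..<k} (\<lambda>_. lborel))"
  using assms
proof (induction k arbitrary: F)
  case 0
  then show ?case
    by (simp add: nn_integral_count_space_finite PiM_empty)
next
  case (Suc k)
  interpret product_sigma_finite "\<lambda>_::nat. lborel :: real measure"
    by unfold_locales
  let ?L = "PiM {0..<k} (\<lambda>_. lborel) :: (nat \<Rightarrow> real) measure"
  let ?c = "\<lambda>k u. \<lambda>i\<in>{0..<k}. \<Sum>j\<le>i. w j * u j"
  have w: "0 < w k" and w': "\<And>j. j < k \<Longrightarrow> 0 < w j"
    using Suc.prems by auto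
  have set: "{0..<Suc k} = insert k {0..<k}" by auto
  have F[measurable]: "F \<in> borel_measurable (PiM (insert k {0..<k}) (\<lambda>_. lborel))"
    using Suc.prems by (simp add: set)
  have case_meas[measurable]: "(\<lambda>x. case_nat (0::real) x i) \<in> borel_measurable (PiM {0..<j} (\<lambda>_. lborel))"
    if "i \<le> j" for i j :: nat
    using that by (cases i) (auto intro!: measurable_component_singleton)
  have upd_meas[measurable]: "(\<lambda>(x, u). x(k := case_nat 0 x k + w k * u))
      \<in> measurable (?L \<Otimes>\<^sub>M lborel) (PiM (insert k {0..<k}) (\<lambda>_. lborel))"
    unfolding split_beta
    by (rule measurable_fun_upd[where J="{0..<k}"]) (auto intro!: borel_measurable_add measurable_compose[OF measurable_fst case_meas])
  \<comment> \<open>The innermost integral after the substitution y = x_(k-1) + w_k u. Only the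
    first k coordinates of x enter, so the induction hypothesis applies with \<open>G\<close> in
    place of \<open>F\<close>.\<close>
  define G where "G x = ennreal (w k) *
      (\<integral>\<^sup>+u. F (x(k := case_nat 0 x k + w k * u)) * indicator {0..} u \<partial>lborel)" for x
  have [measurable]: "(\<lambda>(x, u). F (x(k := case_nat 0 x k + w k * u))) \<in> borel_measurable (?L \<Otimes>\<^sub>M lborel)"
    using measurable_compose[OF upd_meas F] by (simp add: split_beta')
  have G[measurable]: "G \<in> borel_measurable ?L"
    unfolding G_def[abs_def] by measurable
  have prod_meas: "(\<lambda>x. \<Prod>i<j. indicator {0::real..} (x i - case_nat 0 x i) :: ennreal)
      \<in> borel_measurable (PiM {0..<j} (\<lambda>_. lborel))" for j :: nat
    by (intro borel_measurable_prod_ennreal measurable_compose[OF borel_measurable_diff borel_measurable_indicator]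
        case_meas) (auto intro!: measurable_component_singleton)
  have prod_meas': "(\<lambda>x. \<Prod>i<j. indicator {0..} (x i :: real) :: ennreal)
      \<in> borel_measurable (PiM {0..<j} (\<lambda>_. lborel))" for j :: nat
    by (intro borel_measurable_prod_ennreal measurable_compose[OF _ borel_measurable_indicator])
       (auto intro!: measurable_component_singleton)
  have c_meas: "?c j \<in> measurable (PiM {0..<j} (\<lambda>_. lborel)) (PiM {0..<j} (\<lambda>_. lborel))" for j :: nat
    by (rule measurable_restrict) (auto intro!: borel_measurable_sum borel_measurable_times measurable_component_singleton)
  have prev: "(\<Prod>i<k. indicator {0..} ((x(k := y)) i - case_nat 0 (x(k := y)) i) :: ennreal)
      = (\<Prod>i<k. indicator {0..} (x i - case_nat 0 x i))" for x and y :: real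
    by (intro prod.cong refl) (auto split: nat.splits)
  have "(\<integral>\<^sup>+x. F x * (\<Prod>i<Suc k. indicator {0..} (x i - case_nat 0 x i)) \<partial>PiM {0..<Suc k} (\<lambda>_. lborel))
      = (\<integral>\<^sup>+x. (\<integral>\<^sup>+y. F (x(k := y)) * (\<Prod>i<Suc k. indicator {0..} ((x(k := y)) i - case_nat 0 (x(k := y)) i)) \<partial>lborel) \<partial>?L)"
    unfolding set using prod_meas[of "Suc k"]
    by (intro product_nn_integral_insert) (auto simp: set intro!: borel_measurable_times_ennreal simp del: prod.lessThan_Suc)
  also have "\<dots> = (\<integral>\<^sup>+x. G x * (\<Prod>i<k. indicator {0..} (x i - case_nat 0 x i)) \<partial>?L)"
  proof (rule nn_integral_cong)
    fix x assume x: "x \<in> space ?L"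
    have [measurable]: "(\<lambda>y. F (x(k := y))) \<in> borel_measurable borel"
      using measurable_compose[OF measurable_component_update[OF x, of k] F] by simp
    have "(\<integral>\<^sup>+y. F (x(k := y)) * (\<Prod>i<Suc k. indicator {0..} ((x(k := y)) i - case_nat 0 (x(k := y)) i)) \<partial>lborel)
        = (\<integral>\<^sup>+y. (F (x(k := y)) * indicator {0..} (y - case_nat 0 x k)) * (\<Prod>i<k. indicator {0..} (x i - case_nat 0 x i)) \<partial>lborel)"
      unfolding prod.lessThan_Suc prev by (intro nn_integral_cong) (auto split: nat.splits simp: mult_ac)
    also have "\<dots> = (\<integral>\<^sup>+y. (F (x(k := y)) * indicator {0..} (y - case_nat 0 x k)) \<partial>lborel) * (\<Prod>i<k. indicator {0..} (x i - case_nat 0 x i))"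
      by (rule nn_integral_multc) simp
    also have "(\<integral>\<^sup>+y. (F (x(k := y)) * indicator {0..} (y - case_nat 0 x k)) \<partial>lborel) = G x"
      unfolding G_def
      by (subst nn_integral_real_affine[where c="w k" and t="case_nat 0 x k"])
         (use w in \<open>auto intro!: arg_cong2[where f="(*)"] nn_integral_cong simp: indicator_def zero_le_mult_iff\<close>)
    finally show "(\<integral>\<^sup>+y. F (x(k := y)) * (\<Prod>i<Suc k. indicator {0..} ((x(k := y)) i - case_nat 0 (x(k := y)) i)) \<partial>lborel) = G x * (\<Prod>i<k. indicator {0..} (x i - case_nat 0 x i))" .
  qed
  also have "\<dots> = ennreal (\<Prod>j<k. w j) * (\<integral>\<^sup>+v. G (?c k v) * (\<Prod>j<k. indicator {0..} (v j)) \<partial>?L)"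
    by (rule Suc.IH[OF w' G])
  also have "(\<integral>\<^sup>+v. G (?c k v) * (\<Prod>j<k. indicator {0..} (v j)) \<partial>?L)
      = (\<integral>\<^sup>+v. ennreal (w k) * (\<integral>\<^sup>+u. F (?c (Suc k) (v(k := u))) * (\<Prod>j<Suc k. indicator {0..} ((v(k := u)) j)) \<partial>lborel) \<partial>?L)"
  proof (rule nn_integral_cong)
    fix v assume v: "v \<in> space ?L"
    \<comment> \<open>Changing u_k leaves the earlier partial sums alone, and the last one is its
      predecessor plus w_k u: this is the point at which \<open>G\<close> evaluates
      \<open>F\<close>.\<close>
    have c: "?c (Suc k) (v(k := u)) = (?c k v)(k := case_nat 0 (?c k v) k + w k * u)" for u
    proof -
      have "(\<Sum>j\<le>i. w j * (v(k := u)) j) = (\<Sum>j\<le>i. w j * v j)" if "i < k" for i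
        using that by (intro sum.cong) auto
      then show ?thesis
        by (cases k) (auto simp: fun_eq_iff restrict_def)
    qed
    have p: "(\<Prod>j<Suc k. indicator {0..} ((v(k := u)) j) :: ennreal) = indicator {0..} u * (\<Prod>j<k. indicator {0..} (v j))" for u
      by (auto simp: mult.commute)
    have [measurable]: "(\<lambda>u. F ((?c k v)(k := case_nat 0 (?c k v) k + w k * u))) \<in> borel_measurable borel"
      using measurable_compose[OF measurable_component_update[OF measurable_space[OF c_meas v], of k] F]
      by (auto intro: measurable_compose[where f="\<lambda>u. case_nat 0 (?c k v) k + w k * u"])
    show "G (?c k v) * (\<Prod>j<k. indicator {0..} (v j)) = ennreal (w k) * (\<integral>\<^sup>+u. F (?c (Suc k) (v(k := u))) * (\<Prod>j<Suc k. indicator {0..} ((v(k := u)) j)) \<partial>lborel)"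
      unfolding G_def c p mult.assoc[symmetric]
      by (subst nn_integral_multc, measurable) (simp only: mult.assoc)
  qed
  also have "\<dots> = ennreal (w k) * (\<integral>\<^sup>+v. (\<integral>\<^sup>+u. F (?c (Suc k) (v(k := u))) * (\<Prod>j<Suc k. indicator {0..} ((v(k := u)) j)) \<partial>lborel) \<partial>?L)"
  proof (rule nn_integral_cmult)
    let ?H = "\<lambda>v. F (?c (Suc k) v) * (\<Prod>j<Suc k. indicator {0..} (v j))"
    have "?H \<in> borel_measurable (PiM (insert k {0..<k}) (\<lambda>_. lborel))"
      using prod_meas'[of "Suc k"] measurable_compose[OF c_meas[of "Suc k"], unfolded set, OF F]
      by (auto simp: set intro!: borel_measurable_times_ennreal simp del: prod.lessThan_Suc)
    from measurable_compose[OF measurable_add_dim this]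
    have "(\<lambda>(v, u). ?H (v(k := u))) \<in> borel_measurable (?L \<Otimes>\<^sub>M lborel)"
      by (simp add: split_beta' del: prod.lessThan_Suc)
    then show "(\<lambda>v. \<integral>\<^sup>+u. ?H (v(k := u)) \<partial>lborel) \<in> borel_measurable ?L"
      by (rule lborel.borel_measurable_nn_integral)
  qed
  also have "(\<integral>\<^sup>+v. (\<integral>\<^sup>+u. F (?c (Suc k) (v(k := u))) * (\<Prod>j<Suc k. indicator {0..} ((v(k := u)) j)) \<partial>lborel) \<partial>?L)
    = (\<integral>\<^sup>+v. F (?c (Suc k) v) * (\<Prod>j<Suc k. indicator {0..} (v j)) \<partial>PiM {0..<Suc k} (\<lambda>_. lborel))"
    unfolding set using prod_meas'[of "Suc k"] measurable_compose[OF c_meas[of "Suc k"], unfolded set, OF F]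
    by (intro product_nn_integral_insert[symmetric]) (auto simp: set intro!: borel_measurable_times_ennreal simp del: prod.lessThan_Suc)
  also have "ennreal (\<Prod>j<k. w j) * (ennreal (w k) * X) = ennreal (\<Prod>j<Suc k. w j) * X" for X
    using w w' by (subst prod.lessThan_Suc, subst ennreal_mult)
      (auto simp: mult.assoc intro!: less_imp_le[OF prod_pos])
  finally show ?case .
qed

section \<open>Order statistics of an exponential sample\<close>

lemma sorting_permutation_exists:
  fixes \<omega> :: "nat \<Rightarrow> real"
  obtains p where "p permutes {0..<n}" "\<And>i. i < n \<Longrightarrow> i \<noteq> 0 \<Longrightarrow> \<omega> (p (i - 1)) \<le> \<omega> (p i)"
proof -
  let ?xs = "map \<omega> [0..<n]"
  obtain p where p: "p permutes {..<length ?xs}" "permute_list p ?xs = sort ?xs"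
    by (rule mset_eq_permutation[of "sort ?xs" ?xs]) auto
  have nth: "sort ?xs ! i = \<omega> (p i)" if "i < n" for i
  proof -
    have "p i < n"
      using p(1) that permutes_in_image[of p "{..<n}" i] by simp
    then show ?thesis
      using that p by (simp flip: p(2) add: permute_list_nth)
  qed
  show ?thesis
  proof (rule that[of p])
    show "p permutes {0..<n}"
      using p(1) by (simp add: atLeast0LessThan)
    fix i assume "i < n" "i \<noteq> 0"
    then have "sort ?xs ! (i - 1) \<le> sort ?xs ! i"
      by (intro sorted_nth_mono) auto
    then show "\<omega> (p (i - 1)) \<le> \<omega> (p i)"
      using \<open>i < n\<close> by (simp add: nth)
  qed
qed

text \<open>A sorted list is determined by its multiset. Hence every permutation that sorts the
  sample yields the same order statistics, also when there are ties and several such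
  permutations.\<close>

lemma order_stat_eq_sorting_permutation:
  assumes p: "p permutes {0..<n}"
    and mono: "\<And>i. i < n \<Longrightarrow> i \<noteq> 0 \<Longrightarrow> \<omega> (p (i - 1)) \<le> \<omega> (p i)"
    and "i < n"
  shows "order_stat n \<omega> (Suc i) = \<omega> (p i)"
proof -
  have "sort (map \<omega> [0..<n]) = map (\<lambda>i. \<omega> (p i)) [0..<n]"
  proof (rule properties_for_sort)
    have "image_mset p (mset_set {0..<n}) = mset_set {0..<n}"
      using p by (simp add: image_mset_mset_set permutes_inj_on permutes_image)
    then have "image_mset \<omega> (mset_set {0..<n}) = image_mset (\<lambda>i. \<omega> (p i)) (mset_set {0..<n})"
      by (metis (no_types, lifting) image_mset.compositionality comp_def image_mset_cong)
    then show "mset (map (\<lambda>i. \<omega> (p i)) [0..<n]) = mset (map \<omega> [0..<n])"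
      by (simp add: mset_map flip: mset_set_upto_eq_mset_upto)
    show "sorted (map (\<lambda>i. \<omega> (p i)) [0..<n])"
      unfolding sorted_iff_nth_Suc
    proof (intro allI impI)
      fix i assume "Suc i < length (map (\<lambda>i. \<omega> (p i)) [0..<n])"
      then show "map (\<lambda>i. \<omega> (p i)) [0..<n] ! i \<le> map (\<lambda>i. \<omega> (p i)) [0..<n] ! Suc i"
        using mono[of "Suc i"] by simp
    qed
  qed
  then show ?thesis
    using \<open>i < n\<close> by (simp add: order_stat_def)
qed

text \<open>The term u_j / (n - j) occurs in the m - j partial sums with j \<le> i < m and n - m
  more times in the last summand, so n - j times in all. The case m = n shows that the sum of the
  sample is preserved; general m identifies X.\<close>

lemma total_weighted_spacings:
  fixes u :: "nat \<Rightarrow> real"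
  assumes "m \<le> n"
  shows "(\<Sum>i<m. \<Sum>j\<le>i. u j / real (n - j)) + real (n - m) * (\<Sum>j<m. u j / real (n - j)) = (\<Sum>j<m. u j)"
  using assms
proof (induction m)
  case (Suc m)
  define S t T where "S = (\<Sum>j<m. u j / real (n - j))" and "t = u m / real (n - m)"
    and "T = (\<Sum>i<m. \<Sum>j\<le>i. u j / real (n - j))"
  have "T + real (n - m) * S = (\<Sum>j<m. u j)"
    using Suc by (simp add: S_def T_def)
  moreover have "real (n - m) = 1 + real (n - Suc m)" "real (n - m) * t = u m"
    using Suc.prems by (auto simp: t_def)
  ultimately have "T + (S + t) + real (n - Suc m) * (S + t) = (\<Sum>j<m. u j) + u m"
    by (simp add: algebra_simps del: of_nat_diff)
  then show ?case
    by (simp add: S_def T_def t_def lessThan_Suc_atMost[symmetric] del: of_nat_diff)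
qed simp

lemma sample_measure_eq_density:
  assumes "0 < \<theta>"
  shows "sample_measure n \<theta> = density (PiM {0..<n} (\<lambda>_. lborel))
    (\<lambda>x. \<Prod>i<n. ennreal (exponential_density \<theta> (x i)))"
proof -
  interpret prob_space "density lborel (exponential_density \<theta>)"
    using assms by (rule prob_space_exponential_density)
  show ?thesis
    unfolding sample_measure_def
    by (subst PiM_density) (auto simp: lborel.sigma_finite_measure_axioms sigma_finite_measure_axioms atLeast0LessThan)
qed

lemma prod_exponential_density:
  assumes "0 < \<theta>"
  shows "(\<Prod>i<n. ennreal (exponential_density \<theta> (u i)))
    = ennreal (\<theta> ^ n * exp (- \<theta> * (\<Sum>i<n. u i))) * (\<Prod>i<n. indicator {0..} (u i))"
proof -
  have "(\<Prod>i<n. ennreal (exponential_density \<theta> (u i)))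
      = (\<Prod>i<n. ennreal (\<theta> * exp (- \<theta> * u i)) * indicator {0..} (u i))"
    by (intro prod.cong) (auto simp: exponential_density_def indicator_def mult.commute)
  also have "\<dots> = (\<Prod>i<n. ennreal (\<theta> * exp (- \<theta> * u i))) * (\<Prod>i<n. indicator {0..} (u i))"
    by (rule prod.distrib)
  also have "(\<Prod>i<n. ennreal (\<theta> * exp (- \<theta> * u i))) = ennreal (\<theta> ^ n * exp (- \<theta> * (\<Sum>i<n. u i)))"
    using assms by (subst prod_ennreal) (auto simp: prod.distrib exp_sum sum_distrib_left)
  finally show ?thesis .
qed

text \<open>On the sorted region the substitution with weights 1/(n - j) has determinant 1/n! and
  preserves the sum of the coordinates, hence also the joint density. The new variables are
  therefore again an exponential sample, now without any order constraint.\<close>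

lemma sorted_sample_eq_spacings:
  assumes \<theta>: "0 < \<theta>" and F[measurable]: "F \<in> borel_measurable (PiM {0..<n} (\<lambda>_. lborel))"
  shows "(\<integral>\<^sup>+x. F x * (\<Prod>i<n. indicator {0..} (x i - (if i = 0 then x i else x (i - 1)))) \<partial>sample_measure n \<theta>)
    = ennreal (1 / fact n) * (\<integral>\<^sup>+u. F (\<lambda>i\<in>{0..<n}. \<Sum>j\<le>i. u j / real (n - j)) \<partial>sample_measure n \<theta>)"
proof -
  let ?L = "PiM {0..<n} (\<lambda>_. lborel) :: (nat \<Rightarrow> real) measure"
  let ?S = "\<lambda>x. \<Prod>i<n. indicator {0..} (x i - (if i = 0 then x i else x (i - 1))) :: ennreal"
  let ?d = "\<lambda>x. \<Prod>i<n. ennreal (exponential_density \<theta> (x i))"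
  let ?e = "\<lambda>x. ennreal (\<theta> ^ n * exp (- \<theta> * (\<Sum>i<n. x i)))"
  let ?w = "\<lambda>j. 1 / real (n - j)"
  let ?c = "\<lambda>u. \<lambda>i\<in>{0..<n}. \<Sum>j\<le>i. ?w j * u j"
  have comp: "(\<lambda>x. x i) \<in> borel_measurable ?L" if "i < n" for i
    using that measurable_component_singleton[of i "{0..<n}" "\<lambda>_. lborel"] by simp
  have [measurable]: "?S \<in> borel_measurable ?L"
    by (intro borel_measurable_prod_ennreal measurable_compose[OF borel_measurable_diff borel_measurable_indicator])
       (auto intro!: comp)
  have d[measurable]: "?d \<in> borel_measurable ?L"
    by (intro borel_measurable_prod_ennreal measurable_compose[OF comp]) auto
  have sum[measurable]: "(\<lambda>x. \<Sum>i<n. x i) \<in> borel_measurable ?L"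
    by (intro borel_measurable_sum) (auto intro!: comp)
  have c[measurable]: "?c \<in> measurable ?L ?L"
    by (rule measurable_restrict) (auto intro!: borel_measurable_sum borel_measurable_times comp)
  \<comment> \<open>The factor of \<open>?S\<close> for i = 0 is always 1, whereas
    \<open>case_nat\<close> also demands x_0 \<ge> 0. The density makes up for this, since it
    vanishes when a coordinate is negative.\<close>
  have key: "?S x * ?d x = ?e x * (\<Prod>i<n. indicator {0..} (x i - case_nat 0 x i))" for x
  proof (cases "\<forall>i<n. case_nat 0 x i \<le> x i")
    case True
    have "0 \<le> x i" if "i < n" for i
      using that
    proof (induction i)
      case 0
      then show ?case using True by auto
    next
      case (Suc i)
      then show ?case using True[rule_format, of "Suc i"] by simp
    qed
    moreover have "(if i = 0 then x i else x (i - 1)) \<le> x i" if "i < n" for i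
      using that True[rule_format, of i] by (cases i) auto
    ultimately show ?thesis
      using True \<theta> by (simp add: prod_exponential_density)
  next
    case False
    then obtain i where i: "i < n" "x i < case_nat 0 x i"
      by (auto simp: not_le)
    then have "(\<Prod>i<n. indicator {0..} (x i - case_nat 0 x i) :: ennreal) = 0"
      by (auto simp: prod_zero_iff intro!: bexI[of _ i])
    moreover have "?S x * ?d x = 0"
    proof (cases i)
      case 0
      then have "?d x = 0"
        using i by (auto simp: prod_zero_iff exponential_density_def intro!: bexI[of _ i])
      then show ?thesis by simp
    next
      case (Suc j)
      then have "?S x = 0"
        using i by (auto simp: prod_zero_iff intro!: bexI[of _ i])
      then show ?thesis by simp
    qed
    ultimately show ?thesis by (simp only: mult_zero_right)
  qed
  have prod_w: "(\<Prod>j<n. ?w j) = 1 / fact n"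
    by (simp add: prod_dividef fact_prod_rev atLeast0LessThan del: of_nat_diff)
  have e: "?e (?c u) = ?e u" for u
  proof -
    have "(\<Sum>i<n. ?c u i) = (\<Sum>i<n. u i)"
      using total_weighted_spacings[of n n u] by simp
    then show ?thesis by simp
  qed
  have "(\<integral>\<^sup>+x. F x * ?S x \<partial>sample_measure n \<theta>) = (\<integral>\<^sup>+x. ?d x * (F x * ?S x) \<partial>?L)"
    unfolding sample_measure_eq_density[OF \<theta>] by (intro nn_integral_density) auto
  also have "\<dots> = (\<integral>\<^sup>+x. (F x * ?e x) * (\<Prod>i<n. indicator {0..} (x i - case_nat 0 x i)) \<partial>?L)"
    using key by (intro nn_integral_cong) (simp add: mult_ac)
  also have "\<dots> = ennreal (1 / fact n) * (\<integral>\<^sup>+u. (F (?c u) * ?e (?c u)) * (\<Prod>j<n. indicator {0..} (u j)) \<partial>?L)"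
    unfolding prod_w[symmetric] by (rule nn_integral_increasing_spacings) auto
  also have "(\<integral>\<^sup>+u. (F (?c u) * ?e (?c u)) * (\<Prod>j<n. indicator {0..} (u j)) \<partial>?L)
      = (\<integral>\<^sup>+u. ?d u * F (?c u) \<partial>?L)"
    unfolding e using \<theta> by (intro nn_integral_cong) (simp add: prod_exponential_density mult_ac)
  also have "\<dots> = (\<integral>\<^sup>+u. F (?c u) \<partial>sample_measure n \<theta>)"
    unfolding sample_measure_eq_density[OF \<theta>] by (intro nn_integral_density[symmetric]) auto
  finally show ?thesis by simp
qed

lemma prob_space_sample_measure: "0 < \<theta> \<Longrightarrow> prob_space (sample_measure n \<theta>)"
  unfolding sample_measure_def by (intro prob_space_PiM prob_space_exponential_density)

lemma nn_integral_sample_measure_permute: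
  assumes \<theta>: "0 < \<theta>" and p: "p permutes {0..<n}"
    and F: "F \<in> borel_measurable (PiM {0..<n} (\<lambda>_. lborel))"
  shows "(\<integral>\<^sup>+x. F (\<lambda>i\<in>{0..<n}. x (p i)) \<partial>sample_measure n \<theta>) = (\<integral>\<^sup>+x. F x \<partial>sample_measure n \<theta>)"
proof -
  let ?M = "\<lambda>_::nat. density lborel (exponential_density \<theta>)"
  have sets: "sets (PiM {0..<n} ?M) = sets (PiM {0..<n} (\<lambda>_. lborel))"
    by (intro sets_PiM_cong) auto
  have d: "distr (PiM {0..<n} ?M) (PiM {0..<n} ?M) (\<lambda>\<omega>. \<lambda>i\<in>{0..<n}. \<omega> (p i)) = PiM {0..<n} ?M"
    using p \<theta> permutes_in_image[OF p]
    by (intro distr_PiM_reindex prob_space_exponential_density permutes_inj_on) auto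
  have "(\<integral>\<^sup>+x. F x \<partial>PiM {0..<n} ?M) = (\<integral>\<^sup>+x. F x \<partial>distr (PiM {0..<n} ?M) (PiM {0..<n} ?M) (\<lambda>\<omega>. \<lambda>i\<in>{0..<n}. \<omega> (p i)))"
    unfolding d ..
  also have "\<dots> = (\<integral>\<^sup>+x. F (\<lambda>i\<in>{0..<n}. x (p i)) \<partial>PiM {0..<n} ?M)"
    using F permutes_in_image[OF p]
    by (intro nn_integral_distr measurable_restrict measurable_component_singleton)
       (auto simp: measurable_cong_sets[OF sets refl])
  finally show ?thesis
    by (simp add: sample_measure_def)
qed

text \<open>Renyi's representation in integral form, for functions of the whole ordered vector.
  \<open>order_stat\<close> enters only through equalities that hold pointwise or almost surely;
  laws of statistics are derived from this afterwards.\<close>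

lemma order_statistics_spacings:
  assumes \<theta>: "0 < \<theta>" and F[measurable]: "F \<in> borel_measurable (PiM {0..<n} (\<lambda>_. lborel))"
  shows "(\<integral>\<^sup>+\<omega>. F (\<lambda>i\<in>{0..<n}. order_stat n \<omega> (Suc i)) \<partial>sample_measure n \<theta>)
    = (\<integral>\<^sup>+u. F (\<lambda>i\<in>{0..<n}. \<Sum>j\<le>i. u j / real (n - j)) \<partial>sample_measure n \<theta>)"
proof -
  interpret prob_space "sample_measure n \<theta>"
    using \<theta> by (rule prob_space_sample_measure)
  let ?L = "PiM {0..<n} (\<lambda>_. lborel) :: (nat \<Rightarrow> real) measure"
  let ?P = "{p. p permutes {0..<n}}"
  let ?S = "\<lambda>x. \<Prod>i<n. indicator {0..} (x i - (if i = 0 then x i else x (i - 1))) :: ennreal"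
  let ?r = "\<lambda>p x. \<lambda>i\<in>{0..<n}. x (p i)"
  let ?o = "\<lambda>\<omega>. \<lambda>i\<in>{0..<n}. order_stat n \<omega> (Suc i)"
  \<comment> \<open>h counts the sorting permutations of x. It is at least 1 and has mean 1, so it equals 1
    almost surely, which also settles that ties have probability 0.\<close>
  define h where "h x = (\<Sum>p\<in>?P. ?S (?r p x))" for x :: "nat \<Rightarrow> real"
  have finP: "finite ?P" by (intro finite_permutations) simp
  have cardP: "card ?P = fact n" by (intro card_permutations) auto
  have sets[measurable_cong]: "sets (sample_measure n \<theta>) = sets ?L"
    unfolding sample_measure_def by (intro sets_PiM_cong) auto
  have comp: "(\<lambda>x. x i) \<in> borel_measurable ?L" if "i < n" for i
    using that measurable_component_singleton[of i "{0..<n}" "\<lambda>_. lborel"] by simp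
  have S: "?S \<in> borel_measurable ?L"
    by (intro borel_measurable_prod_ennreal measurable_compose[OF borel_measurable_diff borel_measurable_indicator])
       (auto intro!: comp)
  have r: "?r p \<in> measurable ?L ?L" if "p \<in> ?P" for p
    using that permutes_in_image[of p "{0..<n}"] by (intro measurable_restrict measurable_component_singleton) auto
  have h[measurable]: "h \<in> borel_measurable (sample_measure n \<theta>)"
    unfolding h_def[abs_def] measurable_cong_sets[OF sets refl]
    by (intro borel_measurable_sum measurable_compose[OF r S])
  have S_eq: "?S (?r p x) = (if \<forall>i<n. i \<noteq> 0 \<longrightarrow> x (p (i - 1)) \<le> x (p i) then 1 else 0)" for p and x :: "nat \<Rightarrow> real"
  proof (cases "\<forall>i<n. i \<noteq> 0 \<longrightarrow> x (p (i - 1)) \<le> x (p i)")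
    case True
    then show ?thesis
      by (auto intro!: prod.neutral)
  next
    case False
    then obtain i where "i < n" "i \<noteq> 0" "x (p i) < x (p (i - 1))"
      by (auto simp: not_le)
    then have "?S (?r p x) = 0"
      by (auto simp: prod_zero_iff intro!: bexI[of _ i])
    then show ?thesis
      unfolding if_not_P[OF False] .
  qed
  \<comment> \<open>By exchangeability all n! summands have the same integral, which cancels the
    determinant 1/n!. With \<open>G\<close> constant 1 this gives the mean of \<open>h\<close>, with
    \<open>G\<close> = \<open>F\<close> the claim.\<close>
  have sum_perm: "(\<integral>\<^sup>+x. (\<Sum>p\<in>?P. G (?r p x) * ?S (?r p x)) \<partial>sample_measure n \<theta>)
      = (\<integral>\<^sup>+u. G (\<lambda>i\<in>{0..<n}. \<Sum>j\<le>i. u j / real (n - j)) \<partial>sample_measure n \<theta>)"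
    if G: "G \<in> borel_measurable ?L" for G
  proof -
    have GS: "(\<lambda>x. G x * ?S x) \<in> borel_measurable ?L"
      using G S by (rule borel_measurable_times_ennreal)
    have "(\<integral>\<^sup>+x. (\<Sum>p\<in>?P. G (?r p x) * ?S (?r p x)) \<partial>sample_measure n \<theta>)
        = (\<Sum>p\<in>?P. \<integral>\<^sup>+x. G (?r p x) * ?S (?r p x) \<partial>sample_measure n \<theta>)"
      using measurable_compose[OF r GS] by (intro nn_integral_sum) (simp add: measurable_cong_sets[OF sets refl])
    also have "\<dots> = (\<Sum>p\<in>?P. \<integral>\<^sup>+x. G x * ?S x \<partial>sample_measure n \<theta>)"
      using \<theta> GS by (intro sum.cong refl nn_integral_sample_measure_permute[where F="\<lambda>x. G x * ?S x"]) auto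
    also have "\<dots> = fact n * (ennreal (1 / fact n) *
        (\<integral>\<^sup>+u. G (\<lambda>i\<in>{0..<n}. \<Sum>j\<le>i. u j / real (n - j)) \<partial>sample_measure n \<theta>))"
      using sorted_sample_eq_spacings[OF \<theta> G] by (simp add: cardP)
    also have "(fact n :: ennreal) = ennreal (fact n)"
      by (metis of_nat_fact ennreal_of_nat_eq_real_of_nat)
    also have "ennreal (fact n) * (ennreal (1 / fact n) * X) = X" for X
      by (simp add: mult.assoc[symmetric] ennreal_mult[symmetric])
    finally show ?thesis .
  qed
  have h_ge: "1 \<le> h x" for x
  proof -
    obtain p where p: "p permutes {0..<n}" "\<And>i. i < n \<Longrightarrow> i \<noteq> 0 \<Longrightarrow> x (p (i - 1)) \<le> x (p i)"
      using sorting_permutation_exists[of n x] by auto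
    then have "1 = ?S (?r p x)"
      unfolding S_eq by auto
    also have "\<dots> \<le> h x"
      unfolding h_def using p finP by (intro member_le_sum) auto
    finally show ?thesis .
  qed
  have "(\<integral>\<^sup>+x. h x \<partial>sample_measure n \<theta>) = 1"
    using sum_perm[of "\<lambda>_. 1"] by (simp add: h_def[abs_def] emeasure_space_1)
  then have "(\<integral>\<^sup>+x. h x - 1 \<partial>sample_measure n \<theta>) = 0"
    using h_ge by (subst nn_integral_diff) (auto simp: emeasure_space_1)
  then have "AE x in sample_measure n \<theta>. h x - 1 = 0"
    by (subst (asm) nn_integral_0_iff_AE) auto
  \<comment> \<open>Subtraction on \<open>ennreal\<close> is truncated, so a zero difference only
    gives \<open>h x\<close> \<le> 1; \<open>h_ge\<close> supplies the converse.\<close>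
  then have h_AE: "AE x in sample_measure n \<theta>. h x = 1"
    by eventually_elim (metis h_ge antisym ennreal_minus_eq_0)
  have "(\<integral>\<^sup>+\<omega>. F (?o \<omega>) \<partial>sample_measure n \<theta>) = (\<integral>\<^sup>+\<omega>. F (?o \<omega>) * h \<omega> \<partial>sample_measure n \<theta>)"
    using h_AE by (intro nn_integral_cong_AE) auto
  also have "\<dots> = (\<integral>\<^sup>+x. (\<Sum>p\<in>?P. F (?r p x) * ?S (?r p x)) \<partial>sample_measure n \<theta>)"
    unfolding h_def sum_distrib_left
  proof (intro nn_integral_cong sum.cong refl)
    \<comment> \<open>Where \<open>?S\<close> does not vanish, p sorts x and the two arguments of
      \<open>F\<close> coincide.\<close>
    fix x p assume p: "p \<in> ?P"
    show "F (?o x) * ?S (?r p x) = F (?r p x) * ?S (?r p x)"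
    proof (cases "\<forall>i<n. i \<noteq> 0 \<longrightarrow> x (p (i - 1)) \<le> x (p i)")
      case True
      then have "?o x = ?r p x"
        using p by (intro restrict_ext order_stat_eq_sorting_permutation) auto
      then show ?thesis by simp
    next
      case False
      then show ?thesis
        unfolding S_eq if_not_P[OF False] by simp
    qed
  qed
  also have "\<dots> = (\<integral>\<^sup>+u. F (\<lambda>i\<in>{0..<n}. \<Sum>j\<le>i. u j / real (n - j)) \<partial>sample_measure n \<theta>)"
    by (rule sum_perm[OF F])
  finally show ?thesis .
qed

section \<open>Independence and joint law of the statistics\<close>

lemma indep_vars_PiM_components:
  assumes M: "\<And>i. i \<in> I \<Longrightarrow> prob_space (M i)" and "I \<noteq> {}"
  shows "prob_space.indep_vars (PiM I M) M (\<lambda>i \<omega>. \<omega> i) I"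
proof -
  interpret prob_space "PiM I M"
    using M by (rule prob_space_PiM)
  have "distr (PiM I M) (PiM I M) (\<lambda>x. \<lambda>i\<in>I. x i) = distr (PiM I M) (PiM I M) (\<lambda>x. x)"
    by (intro distr_cong) (auto simp: space_PiM PiE_def extensional_restrict)
  also have "\<dots> = PiM I (\<lambda>i. distr (PiM I M) (M i) (\<lambda>\<omega>. \<omega> i))"
    using M by (auto simp: distr_PiM_component intro!: PiM_cong)
  finally show ?thesis
    using \<open>I \<noteq> {}\<close> by (subst indep_vars_iff_distr_eq_PiM') auto
qed

text \<open>The rates may differ because the lemma serves twice: for the sample with constant rate
  \<theta>, and for the auxiliary product with rates \<open>c i\<close> behind the linear
  form.\<close>

lemma exponential_components:
  fixes r :: "'i \<Rightarrow> real"
  assumes r: "\<And>i. i \<in> I \<Longrightarrow> 0 < r i" and "I \<noteq> {}"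
  defines "Q \<equiv> PiM I (\<lambda>i. density lborel (exponential_density (r i)))"
  shows "prob_space.indep_vars Q (\<lambda>_. borel) (\<lambda>i \<omega>. \<omega> i) I"
    and "\<And>i. i \<in> I \<Longrightarrow> distributed Q lborel (\<lambda>\<omega>. \<omega> i) (exponential_density (r i))"
proof -
  let ?M = "\<lambda>i. density lborel (exponential_density (r i))"
  have M: "\<And>i. i \<in> I \<Longrightarrow> prob_space (?M i)"
    using r by (rule prob_space_exponential_density)
  interpret prob_space Q
    unfolding Q_def using M by (rule prob_space_PiM)
  have "indep_vars ?M (\<lambda>i \<omega>. \<omega> i) I"
    unfolding Q_def using M \<open>I \<noteq> {}\<close> by (rule indep_vars_PiM_components)
  from indep_vars_compose2[OF this, of "\<lambda>_ x. x" "\<lambda>_. borel"]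
  show "indep_vars (\<lambda>_. borel) (\<lambda>i \<omega>. \<omega> i) I"
    by simp
  fix i assume i: "i \<in> I"
  have "distr Q lborel (\<lambda>\<omega>. \<omega> i) = distr Q (?M i) (\<lambda>\<omega>. \<omega> i)"
    by (intro distr_cong) auto
  also have "\<dots> = ?M i"
    unfolding Q_def using M i by (rule distr_PiM_component)
  finally show "distributed Q lborel (\<lambda>\<omega>. \<omega> i) (exponential_density (r i))"
    using i measurable_component_singleton[of i I ?M] unfolding distributed_def Q_def by simp
qed

text \<open>The assumption \<open>meas\<close> is available where this is applied: it is contained
  in the \<open>distributed\<close> statements about the statistics.\<close>

lemma distr_order_statistics:
  assumes \<theta>: "0 < \<theta>" and T: "T \<in> measurable (PiM {0..<n} (\<lambda>_. lborel)) L"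
    and meas: "(\<lambda>\<omega>. T (\<lambda>i\<in>{0..<n}. order_stat n \<omega> (Suc i))) \<in> measurable (sample_measure n \<theta>) L"
  shows "distr (sample_measure n \<theta>) L (\<lambda>\<omega>. T (\<lambda>i\<in>{0..<n}. order_stat n \<omega> (Suc i)))
    = distr (sample_measure n \<theta>) L (\<lambda>u. T (\<lambda>i\<in>{0..<n}. \<Sum>j\<le>i. u j / real (n - j)))"
proof (rule measure_eqI)
  let ?P = "sample_measure n \<theta>"
  let ?o = "\<lambda>\<omega>. \<lambda>i\<in>{0..<n}. order_stat n \<omega> (Suc i)"
  let ?c = "\<lambda>u. \<lambda>i\<in>{0..<n}. \<Sum>j\<le>i. u j / real (n - j)"
  have sets: "sets ?P = sets (PiM {0..<n} (\<lambda>_. lborel))"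
    unfolding sample_measure_def by (intro sets_PiM_cong) auto
  have comp: "(\<lambda>x. x i) \<in> borel_measurable ?P" if "i < n" for i
    using that measurable_component_singleton[of i "{0..<n}" "\<lambda>_. lborel"]
    by (simp add: measurable_cong_sets[OF sets refl])
  have "?c \<in> measurable ?P (PiM {0..<n} (\<lambda>_. lborel))"
    by (rule measurable_restrict) (auto intro!: borel_measurable_sum borel_measurable_divide comp)
  from measurable_compose[OF this T]
  have meas': "(\<lambda>u. T (?c u)) \<in> measurable ?P L" .
  fix A assume "A \<in> sets (distr ?P L (\<lambda>\<omega>. T (?o \<omega>)))"
  then have A[measurable]: "A \<in> sets L" by simp
  have "emeasure (distr ?P L (\<lambda>\<omega>. T (?o \<omega>))) A = (\<integral>\<^sup>+\<omega>. indicator A (T (?o \<omega>)) \<partial>?P)"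
    using meas by (simp add: nn_integral_distr flip: nn_integral_indicator)
  also have "\<dots> = (\<integral>\<^sup>+u. indicator A (T (?c u)) \<partial>?P)"
    using \<theta> measurable_compose[OF T borel_measurable_indicator[OF A]]
    by (rule order_statistics_spacings[where F="\<lambda>s. indicator A (T s)"])
  also have "\<dots> = emeasure (distr ?P L (\<lambda>u. T (?c u))) A"
    using meas' by (simp add: nn_integral_distr flip: nn_integral_indicator)
  finally show "emeasure (distr ?P L (\<lambda>\<omega>. T (?o \<omega>))) A = emeasure (distr ?P L (\<lambda>u. T (?c u))) A" .
qed simp

text \<open>The sum involves the indices below m and the vector the indices from m to m + N - 1.
  These blocks are disjoint, which gives independence and the product form. The shape is m - 1
  because the library's Erlang density with parameter k belongs to k + 1 summands.\<close>

lemma distributed_spacings_pair: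
  fixes n m N :: nat and \<theta> :: real
  assumes \<theta>: "0 < \<theta>" and m: "1 \<le> m" and N: "1 \<le> N" "N \<le> n - m" and "m < n"
  shows "distributed (sample_measure n \<theta>) lborel (\<lambda>u. \<Sum>j<m. u j) (erlang_density (m - 1) \<theta>)"
    and "distributed (sample_measure n \<theta>) (lborel \<Otimes>\<^sub>M lebN N)
      (\<lambda>u. (\<Sum>j<m. u j, \<lambda>i\<in>{1..N}. u (m + i - 1) / real (n - m - i + 1)))
      (\<lambda>(x, z). ennreal (erlang_density (m - 1) \<theta> x) *
        (\<Prod>i\<in>{1..N}. ennreal (exponential_density (\<theta> * real (n - m - i + 1)) (z i))))"
proof -
  let ?P = "sample_measure n \<theta>"
  interpret prob_space ?P
    using \<theta> by (rule prob_space_sample_measure)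
  define c where "c i = real (n - m - i + 1)" for i
  have c: "0 < c i" for i by (simp add: c_def)
  have ind: "indep_vars (\<lambda>_. borel) (\<lambda>i \<omega>. \<omega> i) {0..<n}"
    and dist: "\<And>i. i \<in> {0..<n} \<Longrightarrow> distributed ?P lborel (\<lambda>\<omega>. \<omega> i) (exponential_density \<theta>)"
    using exponential_components[of "{0..<n}" "\<lambda>_. \<theta>"] \<theta> \<open>m < n\<close> by (auto simp: sample_measure_def)
  show Y: "distributed ?P lborel (\<lambda>u. \<Sum>j<m. u j) (erlang_density (m - 1) \<theta>)"
  proof -
    have "indep_vars (\<lambda>_. borel) (\<lambda>i \<omega>. \<omega> i) {..<m}"
      using \<open>m < n\<close> by (intro indep_vars_subset[OF ind]) auto
    then show ?thesis
      using exponential_distributed_sum[of "{..<m}" \<theta> "\<lambda>i \<omega>. \<omega> i"] dist m \<theta> \<open>m < n\<close>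
      by (auto simp: lessThan_empty_iff)
  qed
  \<comment> \<open>For each component: an exponential density is an Erlang density of shape 0, and
    division by \<open>c i\<close> multiplies its rate by \<open>c i\<close>.\<close>
  let ?V = "\<lambda>u. \<lambda>i\<in>{1..N}. u (m + i - 1) / c i"
  have Vi: "distributed ?P lborel (\<lambda>u. u (m + i - 1) / c i) (exponential_density (\<theta> * c i))" if "i \<in> {1..N}" for i
    using erlang_distributed_mult_const[of "\<lambda>u. u (m + i - 1)" 0 \<theta> "1 / c i"] dist[of "m + i - 1"] that N \<theta> c[of i]
    by (auto simp: less_diff_conv2)
  have lebN: "lebN N = PiM {1..N} (\<lambda>_. lborel)" by (simp add: lebN_def)
  have V: "distributed ?P (lebN N) ?V (\<lambda>z. \<Prod>i\<in>{1..N}. ennreal (exponential_density (\<theta> * c i) (z i)))"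
  proof -
    have meas: "(\<lambda>u. u (m + i - 1) / c i) \<in> borel_measurable ?P" if "i \<in> {1..N}" for i
      using distributed_measurable[OF Vi[OF that]] by simp
    \<comment> \<open>The index shift sends {1..N} injectively into {0..<n}, so the image of the
      product measure is again a product of the same factors.\<close>
    have "indep_vars (\<lambda>_. borel) (\<lambda>i u. u (m + i - 1)) {1..N}"
    proof (subst indep_vars_iff_distr_eq_PiM')
      let ?D = "density lborel (exponential_density \<theta>)"
      show "{1..N} \<noteq> {}" using N by simp
      show "random_variable borel (\<lambda>u. u (m + i - 1))" if "i \<in> {1..N}" for i
        using distributed_measurable[OF dist[of "m + i - 1"]] that N by auto
      have "distr ?P (PiM {1..N} (\<lambda>_. borel)) (\<lambda>u. \<lambda>i\<in>{1..N}. u (m + i - 1))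
          = distr (PiM {0..<n} (\<lambda>_. ?D)) (PiM {1..N} (\<lambda>_. ?D)) (\<lambda>u. \<lambda>i\<in>{1..N}. u (m + i - 1))"
        unfolding sample_measure_def by (intro distr_cong sets_PiM_cong) auto
      also have "\<dots> = PiM {1..N} (\<lambda>_. ?D)"
        using \<theta> N by (intro distr_PiM_reindex prob_space_exponential_density) (auto simp: inj_on_def)
      also have "\<dots> = PiM {1..N} (\<lambda>i. distr ?P borel (\<lambda>u. u (m + i - 1)))"
      proof (rule PiM_cong[OF refl])
        fix i assume "i \<in> {1..N}"
        with distributed_distr_eq_density[OF dist[of "m + i - 1"]] N
        show "?D = distr ?P borel (\<lambda>u. u (m + i - 1))"
          by (auto cong: distr_cong)
      qed
      finally show "distr ?P (PiM {1..N} (\<lambda>_. borel)) (\<lambda>u. \<lambda>i\<in>{1..N}. u (m + i - 1))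
          = PiM {1..N} (\<lambda>i. distr ?P borel (\<lambda>u. u (m + i - 1)))" .
    qed
    from indep_vars_compose2[OF this, of "\<lambda>i x. x / c i" "\<lambda>_. borel"]
    have "indep_vars (\<lambda>_. borel) (\<lambda>i u. u (m + i - 1) / c i) {1..N}"
      by simp
    then have "distr ?P (PiM {1..N} (\<lambda>_. borel)) ?V = PiM {1..N} (\<lambda>i. distr ?P borel (\<lambda>u. u (m + i - 1) / c i))"
      using N meas by (subst (asm) indep_vars_iff_distr_eq_PiM') auto
    also have "distr ?P (PiM {1..N} (\<lambda>_. borel)) ?V = distr ?P (lebN N) ?V"
      unfolding lebN by (intro distr_cong sets_PiM_cong) auto
    also have "PiM {1..N} (\<lambda>i. distr ?P borel (\<lambda>u. u (m + i - 1) / c i))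
        = PiM {1..N} (\<lambda>i. density lborel (exponential_density (\<theta> * c i)))"
    proof (rule PiM_cong[OF refl])
      fix i assume "i \<in> {1..N}"
      from distributed_distr_eq_density[OF Vi[OF this]]
      show "distr ?P borel (\<lambda>u. u (m + i - 1) / c i) = density lborel (exponential_density (\<theta> * c i))"
        by (simp cong: distr_cong)
    qed
    also have "\<dots> = density (lebN N) (\<lambda>z. \<Prod>i\<in>{1..N}. ennreal (exponential_density (\<theta> * c i) (z i)))"
      unfolding lebN using \<theta> c
      by (intro PiM_density) (auto simp: lborel.sigma_finite_measure_axioms
          intro!: prob_space_imp_sigma_finite prob_space_exponential_density)
    finally show ?thesis
      unfolding distributed_def lebN using meas
      by (auto intro!: measurable_restrict borel_measurable_prod_ennreal measurable_compose[OF measurable_component_singleton])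
  qed
  let ?A = "PiM {0..<m} (\<lambda>_. borel) :: (nat \<Rightarrow> real) measure"
    and ?B = "PiM {m..<m+N} (\<lambda>_. borel) :: (nat \<Rightarrow> real) measure"
  let ?a = "\<lambda>\<omega>. restrict \<omega> {0..<m}" and ?b = "\<lambda>\<omega>. restrict \<omega> {m..<m+N}"
  let ?Y = "\<lambda>u. \<Sum>j<m. u j :: real"
  \<comment> \<open>Independence is available for the two restricted vectors; the sum and the scaled
    vector are measurable functions of these, so their joint law is the image of a product
    measure.\<close>
  have "indep_var ?A ?a ?B ?b"
    using N \<open>m < n\<close> by (intro indep_var_restrict[OF ind]) auto
  then have ab: "?a \<in> measurable ?P ?A" "?b \<in> measurable ?P ?B"
    and indep: "distr ?P ?A ?a \<Otimes>\<^sub>M distr ?P ?B ?b = distr ?P (?A \<Otimes>\<^sub>M ?B) (\<lambda>\<omega>. (?a \<omega>, ?b \<omega>))"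
    unfolding indep_var_distribution_eq by auto
  have Ya: "?Y \<in> measurable ?A lborel" and Vb: "?V \<in> measurable ?B (lebN N)"
    unfolding lebN
    by (auto intro!: measurable_restrict borel_measurable_sum borel_measurable_divide measurable_component_singleton)
       linarith+
  have Y_a: "?Y (?a u) = ?Y u" and V_b: "?V (?b u) = ?V u" for u
    by (auto simp: fun_eq_iff restrict_def intro!: sum.cong)
  have indep: "distr ?P lborel ?Y \<Otimes>\<^sub>M distr ?P (lebN N) ?V = distr ?P (lborel \<Otimes>\<^sub>M lebN N) (\<lambda>u. (?Y u, ?V u))"
  proof -
    have "distr ?P lborel ?Y = distr (distr ?P ?A ?a) lborel ?Y"
      by (simp add: distr_distr[OF Ya ab(1)] comp_def Y_a)
    moreover have V_eq: "distr ?P (lebN N) ?V = distr (distr ?P ?B ?b) (lebN N) ?V"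
      by (subst distr_distr[OF Vb ab(2)]) (simp only: comp_def V_b)
    moreover have "sigma_finite_measure (distr (distr ?P ?B ?b) (lebN N) ?V)"
      unfolding V_eq[symmetric]
      by (intro prob_space_imp_sigma_finite prob_space_distr distributed_measurable[OF V])
    ultimately have "distr ?P lborel ?Y \<Otimes>\<^sub>M distr ?P (lebN N) ?V
        = distr (distr ?P ?A ?a \<Otimes>\<^sub>M distr ?P ?B ?b) (lborel \<Otimes>\<^sub>M lebN N) (\<lambda>(x, y). (?Y x, ?V y))"
      using Ya Vb by (simp add: pair_measure_distr)
    also have "\<dots> = distr ?P (lborel \<Otimes>\<^sub>M lebN N) ((\<lambda>(x, y). (?Y x, ?V y)) \<circ> (\<lambda>\<omega>. (?a \<omega>, ?b \<omega>)))"
      unfolding indep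
    proof (rule distr_distr)
      show "(\<lambda>(x, y). (?Y x, ?V y)) \<in> measurable (?A \<Otimes>\<^sub>M ?B) (lborel \<Otimes>\<^sub>M lebN N)"
        unfolding split_beta'
        by (intro measurable_Pair measurable_compose[OF measurable_fst Ya] measurable_compose[OF measurable_snd Vb])
      show "(\<lambda>\<omega>. (?a \<omega>, ?b \<omega>)) \<in> measurable ?P (?A \<Otimes>\<^sub>M ?B)"
        using ab by (intro measurable_Pair) auto
    qed
    finally show ?thesis
      by (simp only: comp_def prod.case Y_a V_b)
  qed
  interpret lebN: product_sigma_finite "\<lambda>_::nat. lborel :: real measure"
    by unfold_locales
  have "sigma_finite_measure (lebN N)"
    unfolding lebN by (rule lebN.sigma_finite) simp
  from distributed_joint_indep'[OF lborel.sigma_finite_measure_axioms this Y V indep]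
  show "distributed (sample_measure n \<theta>) (lborel \<Otimes>\<^sub>M lebN N)
      (\<lambda>u. (\<Sum>j<m. u j, \<lambda>i\<in>{1..N}. u (m + i - 1) / real (n - m - i + 1)))
      (\<lambda>(x, z). ennreal (erlang_density (m - 1) \<theta> x) *
        (\<Prod>i\<in>{1..N}. ennreal (exponential_density (\<theta> * real (n - m - i + 1)) (z i))))"
    by (simp add: c_def)
qed

text \<open>A shift of index: order statistics are counted from 1 and s from 0, so X_{m+i:n} is
  \<open>s (m + i - 1)\<close>. Since m and i are at least 1, the subtractions on \<open>nat\<close>
  are exact.\<close>

lemma statistics_of_order_statistics:
  assumes "m + N \<le> n" "1 \<le> m"
  shows "statX n m \<omega> = (let s = (\<lambda>i\<in>{0..<n}. order_stat n \<omega> (Suc i)) in (\<Sum>i<m. s i) + real (n - m) * s (m - 1))"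
    and "statZ n m N \<omega> = (let s = (\<lambda>i\<in>{0..<n}. order_stat n \<omega> (Suc i)) in (\<lambda>i\<in>{1..N}. s (m + i - 1) - s (m + i - 2)))"
proof -
  have "(\<Sum>i=1..m. order_stat n \<omega> i) = (\<Sum>i<m. order_stat n \<omega> (Suc i))"
    by (rule sum.reindex_bij_witness[of _ Suc "\<lambda>i. i - 1"]) auto
  then show "statX n m \<omega> = (let s = (\<lambda>i\<in>{0..<n}. order_stat n \<omega> (Suc i)) in (\<Sum>i<m. s i) + real (n - m) * s (m - 1))"
    using assms by (auto simp: statX_def Let_def)
  show "statZ n m N \<omega> = (let s = (\<lambda>i\<in>{0..<n}. order_stat n \<omega> (Suc i)) in (\<lambda>i\<in>{1..N}. s (m + i - 1) - s (m + i - 2)))"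
    unfolding statZ_def Let_def
  proof (rule restrict_ext)
    fix i assume "i \<in> {1..N}"
    moreover from this have "Suc (m + i - 2) = m + i - 1" "Suc (m + i - 1) = m + i"
      using assms by auto
    ultimately show "order_stat n \<omega> (m + i) - order_stat n \<omega> (m + i - 1) =
        (\<lambda>i\<in>{0..<n}. order_stat n \<omega> (Suc i)) (m + i - 1) - (\<lambda>i\<in>{0..<n}. order_stat n \<omega> (Suc i)) (m + i - 2)"
      using assms by (auto simp del: of_nat_diff)
  qed
qed

lemma statistics_of_spacings:
  fixes u :: "nat \<Rightarrow> real"
  assumes "m + N \<le> n" "1 \<le> m"
  defines "s \<equiv> (\<lambda>i\<in>{0..<n}. \<Sum>j\<le>i. u j / real (n - j))"
  shows "(\<Sum>i<m. s i) + real (n - m) * s (m - 1) = (\<Sum>j<m. u j)"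
    and "(\<lambda>i\<in>{1..N}. s (m + i - 1) - s (m + i - 2)) = (\<lambda>i\<in>{1..N}. u (m + i - 1) / real (n - m - i + 1))"
proof -
  have "{..m - 1} = {..<m}"
    using assms(2) by auto
  then have "s (m - 1) = (\<Sum>j<m. u j / real (n - j))"
    using assms(1,2) by (simp add: s_def)
  moreover have "(\<Sum>i<m. s i) = (\<Sum>i<m. \<Sum>j\<le>i. u j / real (n - j))"
    using assms(1) by (simp add: s_def)
  ultimately show "(\<Sum>i<m. s i) + real (n - m) * s (m - 1) = (\<Sum>j<m. u j)"
    using total_weighted_spacings[of m n u] assms(1) by simp
  show "(\<lambda>i\<in>{1..N}. s (m + i - 1) - s (m + i - 2)) = (\<lambda>i\<in>{1..N}. u (m + i - 1) / real (n - m - i + 1))"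
  proof (rule restrict_ext)
    fix i assume i: "i \<in> {1..N}"
    then obtain k where k: "m + i - 1 = Suc k" "m + i - 2 = k"
      using assms(2) by (cases "m + i - 1") auto
    moreover have "Suc k < n" "n - Suc k = n - m - i + 1"
      using i k assms(1,2) by auto
    ultimately show "s (m + i - 1) - s (m + i - 2) = u (m + i - 1) / real (n - m - i + 1)"
      by (simp add: s_def del: of_nat_diff)
  qed
qed

text \<open>The statistics are the same functions of the ordered sample as the Erlang sum and the
  scaled vector are of the partial sums, and the two vectors have equal laws. Densities with respect
  to a sigma-finite measure are unique up to null sets.\<close>

lemma joint_density_unique:
  assumes \<theta>: "0 < \<theta>" and m: "1 \<le> m" and N: "1 \<le> N" "N \<le> n - m" and "m < n"
  shows "distributed (sample_measure n \<theta>) lborel (statX n m) f \<Longrightarrow>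
      AE x in lborel. f x = ennreal (erlang_density (m - 1) \<theta> x)"
    and "distributed (sample_measure n \<theta>) (lborel \<Otimes>\<^sub>M lebN N) (\<lambda>\<omega>. (statX n m \<omega>, statZ n m N \<omega>)) g \<Longrightarrow>
      AE (x, z) in lborel \<Otimes>\<^sub>M lebN N. g (x, z) = ennreal (erlang_density (m - 1) \<theta> x) *
        (\<Prod>i\<in>{1..N}. ennreal (exponential_density (\<theta> * real (n - m - i + 1)) (z i)))"
proof -
  let ?P = "sample_measure n \<theta>"
  let ?L = "PiM {0..<n} (\<lambda>_. lborel) :: (nat \<Rightarrow> real) measure"
  let ?TX = "\<lambda>s. (\<Sum>i<m. s i) + real (n - m) * s (m - 1)"
  let ?TZ = "\<lambda>s. \<lambda>i\<in>{1..N}. s (m + i - 1) - s (m + i - 2)"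
  interpret prob_space ?P
    using \<theta> by (rule prob_space_sample_measure)
  interpret leb: product_sigma_finite "\<lambda>_::nat. lborel :: real measure"
    by unfold_locales
  interpret lebN: sigma_finite_measure "lebN N"
    unfolding lebN_def by (rule leb.sigma_finite) simp
  interpret pair_sigma_finite "lborel :: real measure" "lebN N" ..
  have mN: "m + N \<le> n" using N \<open>m < n\<close> by simp
  note XZ = statistics_of_order_statistics[OF mN m, unfolded Let_def]
  note YV = statistics_of_spacings[OF mN m]
  note dYV = distributed_spacings_pair[OF \<theta> m N \<open>m < n\<close>]
  have comp: "(\<lambda>x. x i) \<in> borel_measurable ?L" if "i < n" for i
    using that measurable_component_singleton[of i "{0..<n}" "\<lambda>_. lborel"] by simp
  have TX: "?TX \<in> measurable ?L lborel"
    using m \<open>m < n\<close> by (auto intro!: borel_measurable_add borel_measurable_sum borel_measurable_times comp)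
  have TZ: "?TZ \<in> measurable ?L (lebN N)"
    unfolding lebN_def using N \<open>m < n\<close> by (intro measurable_restrict) (auto intro!: borel_measurable_diff comp)
  {
    assume d: "distributed ?P lborel (statX n m) f"
    have "distr ?P lborel (statX n m) = distr ?P lborel (\<lambda>u. \<Sum>j<m. u j)"
      using distr_order_statistics[OF \<theta> TX] distributed_measurable[OF d]
      unfolding XZ(1)[abs_def] YV by simp
    then have "density lborel f = density lborel (\<lambda>x. ennreal (erlang_density (m - 1) \<theta> x))"
      using distributed_distr_eq_density[OF d] distributed_distr_eq_density[OF dYV(1)] by simp
    then show "AE x in lborel. f x = ennreal (erlang_density (m - 1) \<theta> x)"
      using distributed_borel_measurable[OF d] 
      by (intro sigma_finite_measure.density_unique[OF lborel.sigma_finite_measure_axioms]) auto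
  }
  {
    assume d: "distributed ?P (lborel \<Otimes>\<^sub>M lebN N) (\<lambda>\<omega>. (statX n m \<omega>, statZ n m N \<omega>)) g"
    have "distr ?P (lborel \<Otimes>\<^sub>M lebN N) (\<lambda>\<omega>. (statX n m \<omega>, statZ n m N \<omega>))
        = distr ?P (lborel \<Otimes>\<^sub>M lebN N) (\<lambda>u. (\<Sum>j<m. u j, \<lambda>i\<in>{1..N}. u (m + i - 1) / real (n - m - i + 1)))"
      using distr_order_statistics[OF \<theta> measurable_Pair[OF TX TZ]] distributed_measurable[OF d]
      unfolding XZ(1)[abs_def] XZ(2)[abs_def] YV by simp
    then have "density (lborel \<Otimes>\<^sub>M lebN N) g = density (lborel \<Otimes>\<^sub>M lebN N)
      (\<lambda>(x, z). ennreal (erlang_density (m - 1) \<theta> x) *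
        (\<Prod>i\<in>{1..N}. ennreal (exponential_density (\<theta> * real (n - m - i + 1)) (z i))))"
      using distributed_distr_eq_density[OF d] distributed_distr_eq_density[OF dYV(2)] by simp
    from density_unique[OF distributed_borel_measurable[OF d] distributed_borel_measurable[OF dYV(2)] this]
    show "AE (x, z) in lborel \<Otimes>\<^sub>M lebN N. g (x, z) = ennreal (erlang_density (m - 1) \<theta> x) *
        (\<Prod>i\<in>{1..N}. ennreal (exponential_density (\<theta> * real (n - m - i + 1)) (z i)))"
      by (simp add: split_beta')
  }
qed

section \<open>From equality almost everywhere to equality at every point\<close>

text \<open>If f and g differ at x, disjoint neighbourhoods of the two values pull back to a
  relatively open set around x on which they differ. The assumption \<open>pos\<close> asks for a
  measurable subset of positive measure, so that open sets of a function space need not be matched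
  with the product sigma-algebra.\<close>

lemma continuous_AE_eq_imp_eq:
  fixes f g :: "'a::topological_space \<Rightarrow> 'b::t2_space"
  assumes f: "continuous_on S f" and g: "continuous_on S g"
    and AE: "AE x in M. x \<in> S \<longrightarrow> f x = g x"
    and pos: "\<And>U x. open U \<Longrightarrow> x \<in> U \<inter> S \<Longrightarrow> \<exists>A\<in>sets M. A \<subseteq> U \<inter> S \<and> emeasure M A \<noteq> 0"
    and "x \<in> S"
  shows "f x = g x"
proof (rule ccontr)
  assume "f x \<noteq> g x"
  then obtain V W where VW: "open V" "open W" "f x \<in> V" "g x \<in> W" "V \<inter> W = {}"
    by (auto dest: hausdorff)
  obtain U1 where U1: "open U1" "U1 \<inter> S = f -` V \<inter> S"
    using f VW(1) unfolding continuous_on_open_invariant by blast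
  obtain U2 where U2: "open U2" "U2 \<inter> S = g -` W \<inter> S"
    using g VW(2) unfolding continuous_on_open_invariant by blast
  note U = U1 U2
  have "x \<in> (U1 \<inter> U2) \<inter> S"
    using U VW \<open>x \<in> S\<close> by blast
  then obtain A where A: "A \<in> sets M" "A \<subseteq> (U1 \<inter> U2) \<inter> S" "emeasure M A \<noteq> 0"
    using pos[of "U1 \<inter> U2" x] U by auto
  have "AE y in M. y \<notin> A"
    using AE
  proof eventually_elim
    case (elim y)
    show ?case
    proof
      assume "y \<in> A"
      then have "y \<in> U1 \<inter> S" "y \<in> U2 \<inter> S"
        using A(2) by auto
      then have "f y \<in> V" "g y \<in> W" "y \<in> S"
        unfolding U by auto
      then show False
        using elim VW(5) by auto
    qed
  qed
  then have "emeasure M A = 0"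
    using A(1) sets.sets_into_space[OF A(1)] by (subst (asm) AE_iff_measurable[OF A(1)]) auto
  with A(3) show False ..
qed

lemma emeasure_lborel_open_pos:
  fixes U :: "real set"
  assumes "open U" "U \<noteq> {}"
  shows "emeasure lborel U \<noteq> 0"
proof -
  obtain x e where "0 < e" "ball x e \<subseteq> U"
    using assms by (meson all_not_in_conv openE)
  then have "emeasure lborel (ball x e) \<le> emeasure lborel U"
    using assms by (intro emeasure_mono) auto
  moreover have "0 < emeasure lborel (ball x e)"
    using \<open>0 < e\<close> by (simp add: ball_eq_greaterThanLessThan)
  ultimately show ?thesis by auto
qed

text \<open>The topology on \<open>nat \<Rightarrow> real\<close> sees every natural number as a
  coordinate, \<open>lebN N\<close> only 1 to N. A basic open box around z is cut down to these
  coordinates and to positive values.\<close>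

lemma pair_lebN_open_pos:
  fixes U :: "(real \<times> (nat \<Rightarrow> real)) set"
  assumes "open U" "x \<in> U \<inter> ({0<..} \<times> pos_orthant N)"
  shows "\<exists>A\<in>sets (lborel \<Otimes>\<^sub>M lebN N). A \<subseteq> U \<inter> ({0<..} \<times> pos_orthant N)
    \<and> emeasure (lborel \<Otimes>\<^sub>M lebN N) A \<noteq> 0"
proof -
  interpret leb: product_sigma_finite "\<lambda>_::nat. lborel :: real measure"
    by unfold_locales
  interpret lebN: sigma_finite_measure "lebN N"
    unfolding lebN_def by (rule leb.sigma_finite) simp
  obtain y z where x: "x = (y, z)" "0 < y" "z \<in> pos_orthant N" "(y, z) \<in> U"
    using assms by (cases x) auto
  obtain V W where VW: "open V" "open W" "y \<in> V" "z \<in> W" "V \<times> W \<subseteq> U"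
    using \<open>open U\<close> x by (auto elim: open_prod_elim)
  from VW(2) have "openin (product_topology (\<lambda>_. euclidean) UNIV) W"
    by (simp add: open_fun_def)
  from product_topology_open_contains_basis[OF this \<open>z \<in> W\<close>]
  obtain X where X: "z \<in> (\<Pi>\<^sub>E i\<in>UNIV. X i)" "\<And>i. open (X i)" "(\<Pi>\<^sub>E i\<in>UNIV. X i) \<subseteq> W"
    by auto
  let ?V = "V \<inter> {0<..}" and ?B = "PiE {1..N} (\<lambda>i. X i \<inter> {0<..})"
  have B: "?B \<in> sets (lebN N)"
    unfolding lebN_def using X(2) by (intro sets_PiM_I_finite) auto
  have V: "?V \<in> sets borel"
    using VW(1) by (intro borel_open open_Int) auto
  have "emeasure (lborel \<Otimes>\<^sub>M lebN N) (?V \<times> ?B) = emeasure lborel ?V * emeasure (lebN N) ?B"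
    using V B by (intro lebN.emeasure_pair_measure_Times) auto
  also have "emeasure (lebN N) ?B = (\<Prod>i\<in>{1..N}. emeasure lborel (X i \<inter> {0<..}))"
    unfolding lebN_def using X(2) by (intro leb.emeasure_PiM) auto
  also have "emeasure lborel ?V * \<dots> \<noteq> 0"
  proof -
    have "emeasure lborel (X i \<inter> {0<..}) \<noteq> 0" if "i \<in> {1..N}" for i
    proof (rule emeasure_lborel_open_pos)
      have "z i \<in> X i" "0 < z i"
        using X(1) x(3) that by (auto simp: pos_orthant_def PiE_iff)
      then show "X i \<inter> {0<..} \<noteq> {}" by auto
    qed (use X(2) in auto)
    moreover have "emeasure lborel ?V \<noteq> 0"
      using VW(1,3) x(2) by (intro emeasure_lborel_open_pos) auto
    ultimately show ?thesis
      by (auto simp: prod_zero_iff)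
  qed
  finally have "emeasure (lborel \<Otimes>\<^sub>M lebN N) (?V \<times> ?B) \<noteq> 0" .
  moreover have "?V \<times> ?B \<subseteq> U \<inter> ({0<..} \<times> pos_orthant N)"
  proof -
    \<comment> \<open>Outside {1..N} both v and z take the default value \<open>undefined\<close>,
      so v satisfies the box conditions there because z does.\<close>
    have "v \<in> W \<inter> pos_orthant N" if v: "v \<in> ?B" for v
    proof -
      have "v i \<in> X i" for i
      proof (cases "i \<in> {1..N}")
        case False
        then have "v i = z i"
          using v x(3) by (auto simp: pos_orthant_def PiE_def extensional_def)
        then show ?thesis using X(1) by auto
      qed (use v in auto)
      then have "v \<in> W" using X(3) by blast
      then show ?thesis using v by (auto simp: pos_orthant_def PiE_iff)
    qed
    then show ?thesis using VW(5) by auto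
  qed
  moreover have "?V \<times> ?B \<in> sets (lborel \<Otimes>\<^sub>M lebN N)"
    using V B by (intro pair_measureI) auto
  ultimately show ?thesis by blast
qed

lemma prod_exponential_density_orthant:
  assumes "z \<in> pos_orthant N"
  shows "(\<Prod>i\<in>{1..N}. exponential_density (\<theta> * c i) (z i))
    = \<theta> ^ N * (\<Prod>i=1..N. c i) * exp (- \<theta> * (\<Sum>i=1..N. c i * z i))"
proof -
  have "(\<Prod>i\<in>{1..N}. exponential_density (\<theta> * c i) (z i)) = (\<Prod>i\<in>{1..N}. \<theta> * c i * exp (- \<theta> * (c i * z i)))"
    using assms by (intro prod.cong) (auto simp: exponential_density_def pos_orthant_def PiE_iff not_less mult_ac dest!: bspec)
  then show ?thesis
    by (simp add: prod.distrib exp_sum sum_distrib_left)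
qed

lemma densities_determined:
  fixes fX :: "real \<Rightarrow> real" and q :: "real \<Rightarrow> (nat \<Rightarrow> real) \<Rightarrow> real"
  assumes \<theta>: "0 < \<theta>" and m: "1 \<le> m" and N: "1 \<le> N" "N \<le> n - m" and "m < n"
    and fX: "distributed (sample_measure n \<theta>) lborel (statX n m) (\<lambda>x. ennreal (fX x))"
    and fX_nonneg: "\<And>x. 0 \<le> fX x" and fX_cont: "continuous_on {0<..} fX"
    and q: "is_cond_density (sample_measure n \<theta>) (statX n m) (statZ n m N) (lebN N) fX q"
    and q_cont: "continuous_on ({0<..} \<times> pos_orthant N) (\<lambda>(x, z). q x z)"
    and "0 < x"
  shows "fX x = erlang_density (m - 1) \<theta> x"
    and "z \<in> pos_orthant N \<Longrightarrow> q x z = \<theta> ^ N * (\<Prod>i=1..N. real (n - m - i + 1))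
      * exp (- \<theta> * (\<Sum>i=1..N. real (n - m - i + 1) * z i))"
proof -
  let ?S = "{0<..} \<times> pos_orthant N"
  let ?c = "\<lambda>i. real (n - m - i + 1)"
  let ?G = "\<lambda>z. \<theta> ^ N * (\<Prod>i=1..N. ?c i) * exp (- \<theta> * (\<Sum>i=1..N. ?c i * z i))"
  \<comment> \<open>The Erlang formula without its case distinction: it is continuous and agrees
    with the Erlang density for x > 0.\<close>
  let ?h = "\<lambda>x. \<theta> ^ Suc (m - 1) * x ^ (m - 1) * exp (- \<theta> * x) / fact (m - 1)"
  note unique = joint_density_unique[OF \<theta> m N \<open>m < n\<close>]
  have fX_eq: "fX x = ?h x" if "0 < x" for x
  proof (rule continuous_AE_eq_imp_eq[where f=fX and g="?h" and S="{0<..}" and M=lborel])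
    show "continuous_on {0<..} ?h" by (intro continuous_intros) auto
    show "AE x in lborel. x \<in> {0<..} \<longrightarrow> fX x = ?h x"
      using unique(1)[OF fX]
    proof eventually_elim
      case (elim x)
      then have "fX x = erlang_density (m - 1) \<theta> x"
        using fX_nonneg[of x] \<theta> by (simp add: ennreal_inj)
      then show ?case by (auto simp: erlang_density_def)
    qed
    show "\<exists>A\<in>sets lborel. A \<subseteq> U \<inter> {0<..} \<and> emeasure lborel A \<noteq> 0"
      if "open U" "x \<in> U \<inter> {0<..}" for U and x :: real
      using that by (intro bexI[of _ "U \<inter> {0<..}"] conjI emeasure_lborel_open_pos) auto
  qed (use fX_cont that in auto)
  then show "fX x = erlang_density (m - 1) \<theta> x"
    using \<open>0 < x\<close> by (simp add: erlang_density_def)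
  have d: "distributed (sample_measure n \<theta>) (lborel \<Otimes>\<^sub>M lebN N) (\<lambda>\<omega>. (statX n m \<omega>, statZ n m N \<omega>))
        (\<lambda>(x, z). ennreal (fX x * q x z))" and q_nonneg: "\<And>x z. 0 \<le> q x z"
    using q by (auto simp: is_cond_density_def)
  {
    assume z: "z \<in> pos_orthant N"
    have "(\<lambda>(x, z). fX x * q x z) (x, z) = (\<lambda>(x, z). ?h x * ?G z) (x, z)"
    proof (rule continuous_AE_eq_imp_eq[where f="\<lambda>(x, z). fX x * q x z" and g="\<lambda>(x, z). ?h x * ?G z" and S="?S" and M="lborel \<Otimes>\<^sub>M lebN N"])
      show "continuous_on ?S (\<lambda>(x, z). fX x * q x z)"
        using q_cont unfolding split_beta'
        by (intro continuous_on_mult continuous_on_compose2[OF fX_cont continuous_on_fst]) (auto intro: continuous_intros)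
      have "continuous_on ?S (\<lambda>p. snd p i)" for i
        by (rule continuous_on_compose2[OF continuous_on_product_coordinates continuous_on_snd]) (auto intro: continuous_intros)
      then show "continuous_on ?S (\<lambda>(x, z). ?h x * ?G z)"
        unfolding split_beta' by (intro continuous_intros) auto
      show "AE p in lborel \<Otimes>\<^sub>M lebN N. p \<in> ?S \<longrightarrow> (case p of (x, z) \<Rightarrow> fX x * q x z) = (case p of (x, z) \<Rightarrow> ?h x * ?G z)"
        using unique(2)[OF d]
      proof eventually_elim
        case (elim p)
        obtain x z where p: "p = (x, z)" by (cases p)
        have "ennreal (fX x * q x z) = ennreal (erlang_density (m - 1) \<theta> x) *
            (\<Prod>i\<in>{1..N}. ennreal (exponential_density (\<theta> * ?c i) (z i)))"
          using elim by (simp add: p)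
        also have "\<dots> = ennreal (erlang_density (m - 1) \<theta> x * (\<Prod>i\<in>{1..N}. exponential_density (\<theta> * ?c i) (z i)))"
          using \<theta> by (subst prod_ennreal) (auto simp: ennreal_mult prod_nonneg)
        finally have "fX x * q x z = erlang_density (m - 1) \<theta> x * (\<Prod>i\<in>{1..N}. exponential_density (\<theta> * ?c i) (z i))"
          using fX_nonneg[of x] q_nonneg[of x z] \<theta> by (subst (asm) ennreal_inj) (auto intro!: prod_nonneg mult_nonneg_nonneg)
        then show ?case
          using prod_exponential_density_orthant[of z N \<theta> ?c] by (auto simp: p erlang_density_def)
      qed
    qed (use \<open>0 < x\<close> z pair_lebN_open_pos in auto)
    then have "?h x * q x z = ?h x * ?G z"
      using fX_eq[OF \<open>0 < x\<close>] by simp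
    \<comment> \<open>The joint law determines only the product of \<open>fX\<close> and
      \<open>q\<close>; dividing by the marginal, which is nonzero at x > 0, isolates
      \<open>q\<close>.\<close>
    moreover have "?h x \<noteq> 0" using \<open>0 < x\<close> \<theta> by simp
    ultimately show "q x z = ?G z" by (simp only: mult_cancel_left simp_thms)
  }
qed

section \<open>Gamma integrals and the image of Lebesgue measure under the linear form\<close>

lemma has_bochner_integral_Gamma_rate:
  fixes s b :: real
  assumes s: "0 < s" and b: "0 < b"
  shows "has_bochner_integral lborel (\<lambda>t. indicator {0<..} t * (t powr (s - 1) * exp (- b * t))) (Gamma s / b powr s)"
proof (rule has_bochner_integral_nn_integral)
  let ?g = "\<lambda>t. ennreal (indicator {0..} t * t powr (s - 1) / exp t)"
  have [measurable]: "?g \<in> borel_measurable borel" by measurable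
  have "(\<integral>\<^sup>+t. ennreal (indicator {0<..} t * (t powr (s - 1) * exp (- b * t))) \<partial>lborel)
      = (\<integral>\<^sup>+t. ennreal (b powr (1 - s)) * ?g (0 + b * t) \<partial>lborel)"
  proof (rule nn_integral_cong)
    fix t :: real
    show "ennreal (indicator {0<..} t * (t powr (s - 1) * exp (- b * t))) = ennreal (b powr (1 - s)) * ?g (0 + b * t)"
    proof (cases "0 < t")
      case True
      then show ?thesis
        using b by (simp add: ennreal_mult[symmetric] powr_mult exp_minus field_simps powr_diff powr_minus)
    next
      case False
      then show ?thesis
        using b by (auto simp: indicator_def zero_le_mult_iff)
    qed
  qed
  also have "\<dots> = ennreal (b powr (1 - s)) * (\<integral>\<^sup>+t. ?g (0 + b * t) \<partial>lborel)"
    by (rule nn_integral_cmult) measurable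
  also have "\<dots> = ennreal (b powr (- s)) * (ennreal \<bar>b\<bar> * (\<integral>\<^sup>+t. ?g (0 + b * t) \<partial>lborel))"
    using b by (simp add: mult.assoc[symmetric] ennreal_mult[symmetric] powr_diff powr_minus field_simps)
  also have "ennreal \<bar>b\<bar> * (\<integral>\<^sup>+t. ?g (0 + b * t) \<partial>lborel) = (\<integral>\<^sup>+t. ?g t \<partial>lborel)"
    using b by (intro nn_integral_real_affine[symmetric]) auto
  also have "\<dots> = ennreal (Gamma s)"
    using Gamma_conv_nn_integral_real[OF s] by simp
  finally show "(\<integral>\<^sup>+t. ennreal (indicator {0<..} t * (t powr (s - 1) * exp (- b * t))) \<partial>lborel) = ennreal (Gamma s / b powr s)"
    using Gamma_real_pos[OF s] by (simp add: ennreal_mult[symmetric] powr_minus field_simps)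
qed (use Gamma_real_pos[OF s] in \<open>auto simp: indicator_def\<close>)

lemma set_integral_Gamma_rate:
  fixes s b :: real
  assumes "0 < s" "0 < b"
  shows "(LINT t:{0<..}|lborel. K * (t powr (s - 1) * exp (- b * t))) = K * (Gamma s / b powr s)"
  using has_bochner_integral_integral_eq[OF has_bochner_integral_Gamma_rate[OF assms]]
  by (simp add: set_lebesgue_integral_def mult.left_commute)

text \<open>The image of Lebesgue measure under the linear form is read off from the Erlang law of a sum of
  independent exponential variables, after cancelling the factor exp(-w), which depends on z only
  through the value w of the form.\<close>

lemma nn_integral_orthant_linear_form:
  fixes c :: "nat \<Rightarrow> real" and h :: "real \<Rightarrow> ennreal"
  assumes N: "1 \<le> N" and c: "\<And>i. 0 < c i" and h[measurable]: "h \<in> borel_measurable borel"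
  shows "(\<integral>\<^sup>+z. h (\<Sum>i=1..N. c i * z i) * indicator (pos_orthant N) z \<partial>lebN N)
    = (\<integral>\<^sup>+w. h w * (ennreal (w ^ (N - 1) / (fact (N - 1) * (\<Prod>i=1..N. c i))) * indicator {0<..} w) \<partial>lborel)"
proof -
  define C where "C = (\<Prod>i=1..N. c i)"
  have C: "0 < C" unfolding C_def using c by (intro prod_pos) auto
  let ?s = "\<lambda>z. \<Sum>i=1..N. c i * z i"
  let ?M = "\<lambda>i. density lborel (exponential_density (c i))"
  let ?Q = "PiM {1..N} ?M"
  have prob: "prob_space (?M i)" for i
    using c by (rule prob_space_exponential_density)
  interpret prob_space ?Q
    using prob by (rule prob_space_PiM)
  have ind: "indep_vars (\<lambda>_. borel) (\<lambda>i \<omega>. \<omega> i) {1..N}"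
    and dist: "\<And>i. i \<in> {1..N} \<Longrightarrow> distributed ?Q lborel (\<lambda>\<omega>. \<omega> i) (exponential_density (c i))"
    using exponential_components[of "{1..N}" c] c N by auto
  have "distributed ?Q lborel (\<lambda>z. c i * z i) (exponential_density 1)" if "i \<in> {1..N}" for i
    using erlang_distributed_mult_const[OF dist[OF that] c[of i] c[of i]] c[of i] by simp
  moreover have "indep_vars (\<lambda>_. borel) (\<lambda>i z. c i * z i) {1..N}"
    using indep_vars_compose2[OF ind, of "\<lambda>i x. c i * x" "\<lambda>_. borel"] by simp
  ultimately have S: "distributed ?Q lborel ?s (erlang_density (N - 1) 1)"
    using exponential_distributed_sum[of "{1..N}" 1 "\<lambda>i z. c i * z i"] N by simp
  have "?Q = density (PiM {1..N} (\<lambda>_. lborel)) (\<lambda>z. \<Prod>i\<in>{1..N}. ennreal (exponential_density (c i) (z i)))"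
    by (intro PiM_density) (auto simp: lborel.sigma_finite_measure_axioms intro!: prob_space_imp_sigma_finite prob)
  then have Q: "?Q = density (lebN N) (\<lambda>z. \<Prod>i\<in>{1..N}. ennreal (exponential_density (c i) (z i)))"
    by (simp add: lebN_def)
  have comp: "(\<lambda>x. x i) \<in> borel_measurable (lebN N)" if "i \<in> {1..N}" for i
    using that measurable_component_singleton[of i "{1..N}" "\<lambda>_. lborel"] by (simp add: lebN_def)
  have [measurable]: "?s \<in> borel_measurable (lebN N)"
    by (intro borel_measurable_sum borel_measurable_times comp) auto
  have [measurable]: "pos_orthant N \<in> sets (lebN N)"
    unfolding lebN_def pos_orthant_def by (intro sets_PiM_I_finite) auto
  have [measurable]: "(\<lambda>z. \<Prod>i\<in>{1..N}. ennreal (exponential_density (c i) (z i))) \<in> borel_measurable (lebN N)"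
    by (intro borel_measurable_prod_ennreal measurable_compose[OF comp]) auto
  \<comment> \<open>The exponential density is positive at 0, but the orthant is open; its boundary
    is discarded as a null set.\<close>
  have "AE x in lborel. 0 < exponential_density (c i) x \<longrightarrow> 0 < x" for i
    using AE_lborel_singleton[of 0] by eventually_elim (auto simp: exponential_density_def split: if_splits)
  then have "AE x in ?M i. 0 < x" for i
    by (subst AE_density) auto
  then have "AE z in ?Q. \<forall>i\<in>{1..N}. 0 < z i"
    using prob by (intro AE_finite_allI AE_PiM_component) auto
  then have AE: "AE z in ?Q. z \<in> pos_orthant N"
    using AE_space by eventually_elim (auto simp: pos_orthant_def PiE_iff space_PiM)
  \<comment> \<open>The point 0 is exceptional: for N = 1 the Erlang density is 1 there, while the
    indicator of the open half-line is 0.\<close>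
  have AE_w: "AE w in lborel. (0::real) < w \<or> w < 0"
    using AE_lborel_singleton[of 0] by eventually_elim auto
  have "(\<integral>\<^sup>+w. h w * (ennreal (w ^ (N - 1) / (fact (N - 1) * C)) * indicator {0<..} w) \<partial>lborel)
      = (\<integral>\<^sup>+w. ennreal (erlang_density (N - 1) 1 w) * (h w * ennreal (exp w / C)) \<partial>lborel)"
  proof (rule nn_integral_cong_AE, use AE_w in eventually_elim)
    case (elim w)
    have "ennreal (w ^ (N - 1) / (fact (N - 1) * C)) = ennreal (erlang_density (N - 1) 1 w) * ennreal (exp w / C)" if "0 < w"
      using that C by (subst ennreal_mult[symmetric]) (auto simp: erlang_density_def exp_minus field_simps)
    then show ?case
      using elim by (auto simp: mult_ac erlang_density_def)
  qed
  also have "\<dots> = (\<integral>\<^sup>+z. h (?s z) * ennreal (exp (?s z) / C) \<partial>?Q)"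
    by (rule distributed_nn_integral[OF S]) simp
  also have "\<dots> = (\<integral>\<^sup>+z. h (?s z) * ennreal (exp (?s z) / C) * indicator (pos_orthant N) z \<partial>?Q)"
    using AE by (intro nn_integral_cong_AE) auto
  also have "\<dots> = (\<integral>\<^sup>+z. (\<Prod>i\<in>{1..N}. ennreal (exponential_density (c i) (z i))) *
      (h (?s z) * ennreal (exp (?s z) / C) * indicator (pos_orthant N) z) \<partial>lebN N)"
    unfolding Q by (intro nn_integral_density) measurable
  also have "\<dots> = (\<integral>\<^sup>+z. h (?s z) * indicator (pos_orthant N) z \<partial>lebN N)"
  proof (rule nn_integral_cong)
    fix z
    show "(\<Prod>i\<in>{1..N}. ennreal (exponential_density (c i) (z i))) *
        (h (?s z) * ennreal (exp (?s z) / C) * indicator (pos_orthant N) z) = h (?s z) * indicator (pos_orthant N) z"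
    proof (cases "z \<in> pos_orthant N")
      case True
      have "(\<Prod>i\<in>{1..N}. ennreal (exponential_density (c i) (z i))) = ennreal (C * exp (- ?s z))"
        using prod_exponential_density_orthant[OF True, of 1 c] c
        by (subst prod_ennreal) (auto simp: C_def less_imp_le)
      then have "(\<Prod>i\<in>{1..N}. ennreal (exponential_density (c i) (z i))) * ennreal (exp (?s z) / C) = 1"
        using C by (simp add: ennreal_mult[symmetric] exp_minus field_simps)
      moreover have "p * (x * y * indicator (pos_orthant N) z) = (p * y) * x" for p x y :: ennreal
        using True by (simp add: mult_ac)
      ultimately show ?thesis
        using True by simp
    qed simp
  qed
  finally show ?thesis by (simp add: C_def)
qed

section \<open>The Beta type II law and the predictive distribution\<close>

lemma b2_density_nonneg: "0 < a \<Longrightarrow> 0 < M \<Longrightarrow> 0 \<le> b2_density M a w"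
  by (simp add: b2_density_def Gamma_real_pos less_imp_le)

lemma b2_density_pos: "0 < a \<Longrightarrow> 0 < M \<Longrightarrow> 0 < w \<Longrightarrow> 0 < b2_density M a w"
  by (simp add: b2_density_def Gamma_real_pos)

lemma borel_measurable_b2_density[measurable]: "b2_density M a \<in> borel_measurable borel"
  unfolding b2_density_def[abs_def] by measurable

text \<open>The density is positive on the half-open interval from r to r', which has positive
  length. In \<open>ennreal\<close> adding a positive amount is strict only to a finite value, hence
  \<open>fin\<close>.\<close>

lemma b2_integral_strict_mono:
  assumes "0 < a" "0 < M" "0 \<le> r" "r < r'"
    and fin: "(\<integral>\<^sup>+w\<in>{0..r}. ennreal (b2_density M a w) \<partial>lborel) \<noteq> \<infinity>"
  shows "(\<integral>\<^sup>+w\<in>{0..r}. ennreal (b2_density M a w) \<partial>lborel) < (\<integral>\<^sup>+w\<in>{0..r'}. ennreal (b2_density M a w) \<partial>lborel)"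
proof -
  have "(\<integral>\<^sup>+w\<in>{0..r'}. ennreal (b2_density M a w) \<partial>lborel)
      = (\<integral>\<^sup>+w. ennreal (b2_density M a w) * indicator {0..r} w + ennreal (b2_density M a w) * indicator {r<..r'} w \<partial>lborel)"
    using assms by (intro nn_integral_cong) (auto simp: indicator_def)
  also have "\<dots> = (\<integral>\<^sup>+w\<in>{0..r}. ennreal (b2_density M a w) \<partial>lborel) + (\<integral>\<^sup>+w\<in>{r<..r'}. ennreal (b2_density M a w) \<partial>lborel)"
    by (rule nn_integral_add) measurable
  finally have eq: "(\<integral>\<^sup>+w\<in>{0..r'}. ennreal (b2_density M a w) \<partial>lborel) = \<dots>" .
  have "(\<integral>\<^sup>+w\<in>{r<..r'}. ennreal (b2_density M a w) \<partial>lborel) \<noteq> 0"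
  proof
    assume "(\<integral>\<^sup>+w\<in>{r<..r'}. ennreal (b2_density M a w) \<partial>lborel) = 0"
    then have "AE w in lborel. ennreal (b2_density M a w) * indicator {r<..r'} w = 0"
      by (subst (asm) nn_integral_0_iff_AE) auto
    then have "AE w in lborel. w \<notin> {r<..r'}"
    proof eventually_elim
      case (elim w)
      then show ?case
        using b2_density_pos[of a M w] assms by (auto simp: ennreal_eq_0_iff indicator_def split: if_splits)
    qed
    then have "emeasure lborel {r<..r'} = 0"
      by (subst (asm) AE_iff_measurable[of "{r<..r'}"]) auto
    then show False using \<open>r < r'\<close> by simp
  qed
  then have "\<not> x + (\<integral>\<^sup>+w\<in>{r<..r'}. ennreal (b2_density M a w) \<partial>lborel) \<le> x + 0" if "x \<noteq> \<infinity>" for x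
    using that unfolding ennreal_add_left_cancel_le by auto
  from this[OF fin] show ?thesis
    unfolding eq by (simp add: not_le zero_less_iff_neq_zero)
qed

text \<open>Gamma conjugacy: the posterior has shape m + \<alpha> and rate x + \<beta>, and the
  factor \<theta>^N exp(-\<theta> s) raises them by N and s. The factor \<open>K\<close> of the
  likelihood, free of \<theta>, cancels against the evidence. For \<alpha> = \<beta> = 0 the prior
  is improper, but m \<ge> 1 and x > 0 keep both parameters positive.\<close>

lemma bayes_predictive_density:
  fixes m N :: nat and \<alpha> \<beta> x s C :: real
    and fX :: "real \<Rightarrow> real \<Rightarrow> real" and q :: "real \<Rightarrow> real \<Rightarrow> 'b \<Rightarrow> real"
  assumes m: "1 \<le> m" and "0 \<le> \<alpha>" "0 \<le> \<beta>" "0 < x" "0 \<le> s"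
    and fX: "\<And>\<theta>. 0 < \<theta> \<Longrightarrow> fX \<theta> x = erlang_density (m - 1) \<theta> x"
    and q: "\<And>\<theta>. 0 < \<theta> \<Longrightarrow> q \<theta> x z = \<theta> ^ N * C * exp (- \<theta> * s)"
  shows "pred_density q (posterior (gamma_prior \<alpha> \<beta>) fX) x z
    = C * ((x + \<beta>) powr (m + \<alpha>) / Gamma (m + \<alpha>)) * (Gamma (N + (m + \<alpha>)) / (x + \<beta> + s) powr (N + (m + \<alpha>)))"
proof -
  define a b K where "a = m + \<alpha>" and "b = x + \<beta>" and "K = x ^ (m - 1) / fact (m - 1)"
  have ab: "0 < a" "0 < b" "0 < K"
    using assms by (auto simp: a_def b_def K_def)
  have joint: "gamma_prior \<alpha> \<beta> \<theta> * fX \<theta> x = K * (\<theta> powr (a - 1) * exp (- b * \<theta>))" if "0 < \<theta>" for \<theta>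
  proof -
    have "\<theta> powr (a - 1) = \<theta> powr (\<alpha> - 1) * \<theta> ^ m"
      using that by (simp add: a_def powr_realpow[symmetric] powr_add[symmetric] algebra_simps)
    moreover have "exp (- b * \<theta>) = exp (- \<beta> * \<theta>) * exp (- \<theta> * x)"
      by (simp add: b_def exp_add[symmetric] algebra_simps)
    moreover have "fX \<theta> x = \<theta> ^ m * x ^ (m - 1) * exp (- \<theta> * x) / fact (m - 1)"
      using that m \<open>0 < x\<close> by (simp add: fX erlang_density_def del: power_Suc)
    ultimately show ?thesis
      using that by (simp add: gamma_prior_def K_def)
  qed
  have "(LINT t:{0<..}|lborel. gamma_prior \<alpha> \<beta> t * fX t x) = (LINT t:{0<..}|lborel. K * (t powr (a - 1) * exp (- b * t)))"
    using joint by (intro set_lebesgue_integral_cong) auto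
  also have "\<dots> = K * (Gamma a / b powr a)"
    using ab by (intro set_integral_Gamma_rate)
  finally have evid: "(LINT t:{0<..}|lborel. gamma_prior \<alpha> \<beta> t * fX t x) = K * (Gamma a / b powr a)" .
  have "q \<theta> x z * posterior (gamma_prior \<alpha> \<beta>) fX x \<theta>
      = C * (b powr a / Gamma a) * (\<theta> powr (N + a - 1) * exp (- (b + s) * \<theta>))" if "0 < \<theta>" for \<theta>
  proof -
    have "\<theta> powr (N + a - 1) = \<theta> powr (a - 1) * \<theta> ^ N"
      using that by (simp add: powr_realpow[symmetric] powr_add[symmetric] algebra_simps)
    moreover have "exp (- (b + s) * \<theta>) = exp (- b * \<theta>) * exp (- \<theta> * s)"
      by (simp add: exp_add[symmetric] algebra_simps)
    ultimately show ?thesis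
      using that ab Gamma_real_pos[of a]
      unfolding posterior_def evid joint[OF that] q[OF that] by (simp add: field_simps)
  qed
  then have "pred_density q (posterior (gamma_prior \<alpha> \<beta>) fX) x z
      = (LINT \<theta>:{0<..}|lborel. C * (b powr a / Gamma a) * (\<theta> powr (N + a - 1) * exp (- (b + s) * \<theta>)))"
    unfolding pred_density_def by (intro set_lebesgue_integral_cong) auto
  also have "\<dots> = C * (b powr a / Gamma a) * (Gamma (N + a) / (b + s) powr (N + a))"
    using ab \<open>0 \<le> s\<close> by (intro set_integral_Gamma_rate) auto
  finally show ?thesis
    by (simp add: a_def b_def)
qed

text \<open>Passing to the value of the linear form brings in 1 / (\<open>C\<close> (N - 1)!), where
  \<open>C\<close> cancels the normalising product and (N - 1)! is \<open>Gamma N\<close>. Rescaling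
  that value by b then cancels all powers of b against those in (b + b w)^(N + a).\<close>

lemma predictive_integral_eq_b2:
  fixes a b :: real and c :: "nat \<Rightarrow> real"
  assumes N: "1 \<le> N" and a: "0 < a" and b: "0 < b" and c: "\<And>i. 0 < c i"
  shows "(\<integral>\<^sup>+z\<in>{z \<in> pos_orthant N. (\<Sum>i=1..N. c i * z i) \<le> r}.
      ennreal ((\<Prod>i=1..N. c i) * (b powr a / Gamma a) * (Gamma (N + a) / (b + (\<Sum>i=1..N. c i * z i)) powr (N + a))) \<partial>lebN N)
    = (\<integral>\<^sup>+w\<in>{0..r / b}. ennreal (b2_density N a w) \<partial>lborel)"
proof -
  define C where "C = (\<Prod>i=1..N. c i)"
  have C: "0 < C" unfolding C_def using c by (intro prod_pos) auto
  let ?s = "\<lambda>z. \<Sum>i=1..N. c i * z i"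
  define \<phi> where "\<phi> w = C * (b powr a / Gamma a) * (Gamma (N + a) / (b + w) powr (N + a))" for w
  define h where "h w = ennreal (\<phi> w) * indicator {..r} w" for w
  have [measurable]: "\<phi> \<in> borel_measurable borel"
    unfolding \<phi>_def[abs_def] by measurable
  have [measurable]: "h \<in> borel_measurable borel"
    unfolding h_def[abs_def] by measurable
  let ?k = "\<lambda>w. h w * (ennreal (w ^ (N - 1) / (fact (N - 1) * C)) * indicator {0<..} w)"
  have \<phi>: "0 \<le> \<phi> w" for w
    using C a by (simp add: \<phi>_def Gamma_real_pos less_imp_le)
  have "(\<integral>\<^sup>+z\<in>{z \<in> pos_orthant N. ?s z \<le> r}. ennreal (\<phi> (?s z)) \<partial>lebN N)
      = (\<integral>\<^sup>+z. h (?s z) * indicator (pos_orthant N) z \<partial>lebN N)"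
    by (intro nn_integral_cong) (auto simp: h_def indicator_def)
  also have "\<dots> = (\<integral>\<^sup>+w. ?k w \<partial>lborel)"
    unfolding C_def using N c by (intro nn_integral_orthant_linear_form) auto
  also have "\<dots> = ennreal \<bar>b\<bar> * (\<integral>\<^sup>+w. ?k (0 + b * w) \<partial>lborel)"
    using b by (intro nn_integral_real_affine) auto
  also have "\<dots> = (\<integral>\<^sup>+w. ennreal b * ?k (b * w) \<partial>lborel)"
    using b by (subst nn_integral_cmult) auto
  also have "\<dots> = (\<integral>\<^sup>+w\<in>{0..r / b}. ennreal (b2_density N a w) \<partial>lborel)"
  proof (rule nn_integral_cong)
    fix w :: real
    show "ennreal b * ?k (b * w) = ennreal (b2_density N a w) * indicator {0..r / b} w"
    proof (cases "0 < w \<and> w \<le> r / b")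
      case True
      then have w: "0 < w" "b * w \<le> r" using b by (auto simp: field_simps)
      have pw: "(b + b * w) powr (N + a) = b powr a * b ^ N * (1 + w) powr (N + a)"
      proof -
        have "(b + b * w) powr (N + a) = b powr (N + a) * (1 + w) powr (N + a)"
          using b w by (simp add: powr_mult[symmetric] algebra_simps)
        also have "b powr (N + a) = b powr a * b ^ N"
          using b by (simp add: powr_add powr_realpow)
        finally show ?thesis .
      qed
      have Nb: "b ^ N = b * b ^ (N - 1)" "w powr (real N - 1) = w ^ (N - 1)" "Gamma (real N) = fact (N - 1)"
        using N w powr_realpow[of w "N - 1"] Gamma_fact[of "N - 1", where 'a=real]
        by (auto simp: of_nat_diff power_eq_if)
      have pos: "0 < Gamma a" "0 < (1 + w) powr (N + a)" "0 < b powr a" "0 < b ^ (N - 1)" "0 < (fact (N - 1) :: real)"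
        using a b w by (auto simp: Gamma_real_pos)
      have "b * (\<phi> (b * w) * ((b * w) ^ (N - 1) / (fact (N - 1) * C))) = b2_density N a w"
        unfolding \<phi>_def pw b2_density_def Nb using w(1) pos C b by (simp add: field_simps power_mult_distrib)
      moreover have "0 \<le> (b * w) ^ (N - 1) / (fact (N - 1) * C)"
        using b w C by auto
      ultimately have "ennreal b * (ennreal (\<phi> (b * w)) * ennreal ((b * w) ^ (N - 1) / (fact (N - 1) * C))) = ennreal (b2_density N a w)"
        using b \<phi>[of "b * w"] by (metis ennreal_mult less_imp_le mult_nonneg_nonneg)
      then show ?thesis
        using True w b by (simp add: h_def)
    next
      case False
      then consider "w < 0" | "w = 0" | "r < b * w"
        using b by (fastforce simp: field_simps not_less not_le)
      then show ?thesis
      proof cases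
        case 1
        then show ?thesis using b by (auto simp: indicator_def zero_less_mult_iff)
      next
        case 2
        then show ?thesis by (simp add: b2_density_def)
      next
        case 3
        then show ?thesis using b by (auto simp: h_def indicator_def field_simps)
      qed
    qed
  qed
  finally show ?thesis
    by (simp add: \<phi>_def C_def)
qed

section \<open>Identification of the HPD regions\<close>

theorem theorem3:
  fixes n m N :: nat and \<alpha> \<beta> lam c0 x :: real
    and fX :: "real \<Rightarrow> real \<Rightarrow> real"
    and q :: "real \<Rightarrow> real \<Rightarrow> (nat \<Rightarrow> real) \<Rightarrow> real"
  assumes "1 \<le> m" and "m < n" and "2 \<le> N" and "N \<le> n - m"
    and prior: "(0 < \<alpha> \<and> 0 < \<beta>) \<or> (\<alpha> = 0 \<and> \<beta> = 0)"
    and "0 < lam" and "lam < 1"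
    and densX: "\<And>\<theta>. 0 < \<theta> \<Longrightarrow>
        distributed (sample_measure n \<theta>) lborel (statX n m) (\<lambda>x. ennreal (fX \<theta> x))
        \<and> (\<forall>x. 0 \<le> fX \<theta> x) \<and> continuous_on {0<..} (fX \<theta>)"
    and condZ: "\<And>\<theta>. 0 < \<theta> \<Longrightarrow>
        is_cond_density (sample_measure n \<theta>) (statX n m) (statZ n m N) (lebN N) (fX \<theta>) (q \<theta>)
        \<and> continuous_on ({0<..} \<times> pos_orthant N) (\<lambda>(x, z). q \<theta> x z)"
    and c0: "0 < c0" "(LINT w:{0..c0}|lborel. b2_density (real N) (real m + \<alpha>) w) = 1 - lam"
    and "0 < x"
  shows "let qh = pred_density q (posterior (gamma_prior \<alpha> \<beta>) fX) x in
     (\<exists>k. set_nn_integral (lebN N) (hpd_set N qh k) (\<lambda>z. ennreal (qh z)) = ennreal (1 - lam)) \<and>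
     (\<forall>k. set_nn_integral (lebN N) (hpd_set N qh k) (\<lambda>z. ennreal (qh z)) = ennreal (1 - lam)
          \<longrightarrow> hpd_set N qh k =
              {z \<in> pos_orthant N. (\<Sum>i=1..N. real (n - m - i + 1) * z i) \<le> c0 * (x + \<beta>)})"
proof -
  define a b where "a = real m + \<alpha>" and "b = x + \<beta>"
  define c where "c i = real (n - m - i + 1)" for i
  define s where "s z = (\<Sum>i=1..N. c i * z i)" for z
  define qh where "qh = pred_density q (posterior (gamma_prior \<alpha> \<beta>) fX) x"
  define \<phi> where "\<phi> w = (\<Prod>i=1..N. c i) * (b powr a / Gamma a) * (Gamma (N + a) / (b + w) powr (N + a))" for w
  define B where "B r = (\<integral>\<^sup>+w\<in>{0..r}. ennreal (b2_density N a w) \<partial>lborel)" for r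
  let ?I = "\<lambda>A. set_nn_integral (lebN N) A (\<lambda>z. ennreal (qh z))"
  have N: "1 \<le> N" and ab: "0 < a" "0 < b" and c: "\<And>i. 0 < c i"
    using assms by (auto simp: a_def b_def c_def)
  have s_pos: "0 < s z" if "z \<in> pos_orthant N" for z
    unfolding s_def using that c N by (intro sum_pos) (auto simp: pos_orthant_def PiE_iff)
  have qh: "qh z = \<phi> (s z)" if z: "z \<in> pos_orthant N" for z
  proof -
    have "fX \<theta> x = erlang_density (m - 1) \<theta> x"
      and "q \<theta> x z = \<theta> ^ N * (\<Prod>i=1..N. c i) * exp (- \<theta> * s z)" if "0 < \<theta>" for \<theta>
    proof -
      have "distributed (sample_measure n \<theta>) lborel (statX n m) (\<lambda>x. ennreal (fX \<theta> x))"
        "\<And>x. 0 \<le> fX \<theta> x" "continuous_on {0<..} (fX \<theta>)"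
        "is_cond_density (sample_measure n \<theta>) (statX n m) (statZ n m N) (lebN N) (fX \<theta>) (q \<theta>)"
        "continuous_on ({0<..} \<times> pos_orthant N) (\<lambda>(x, z). q \<theta> x z)"
        using densX[OF that] condZ[OF that] by auto
      note det = densities_determined[OF that \<open>1 \<le> m\<close> N \<open>N \<le> n - m\<close> \<open>m < n\<close> this \<open>0 < x\<close>]
      show "fX \<theta> x = erlang_density (m - 1) \<theta> x"
        by (rule det(1))
      show "q \<theta> x z = \<theta> ^ N * (\<Prod>i=1..N. c i) * exp (- \<theta> * s z)"
        using det(2)[OF z] by (simp add: c_def s_def)
    qed
    then show ?thesis
      using bayes_predictive_density[of m \<alpha> \<beta> x "s z" fX q z N "\<Prod>i=1..N. c i"] assms s_pos[OF z]
      by (auto simp: qh_def \<phi>_def a_def b_def)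
  qed
  have \<phi>_less: "\<phi> w' < \<phi> w" if "0 \<le> w" "w < w'" for w w'
  proof -
    define K where "K = (\<Prod>i=1..N. c i) * (b powr a / Gamma a) * Gamma (N + a)"
    have "0 < K"
      unfolding K_def using ab c by (intro mult_pos_pos divide_pos_pos prod_pos Gamma_real_pos) auto
    moreover have "(b + w) powr (N + a) < (b + w') powr (N + a)"
      using that ab by (intro powr_less_mono2) auto
    moreover have "0 < (b + w') powr (N + a) * (b + w) powr (N + a)"
      using that ab by simp
    ultimately have "K / (b + w') powr (N + a) < K / (b + w) powr (N + a)"
      by (intro divide_strict_left_mono)
    then show ?thesis
      by (simp add: \<phi>_def K_def)
  qed
  have int_le: "?I {z \<in> pos_orthant N. s z \<le> r} = B (r / b)" for r
  proof -
    have "?I {z \<in> pos_orthant N. s z \<le> r} = set_nn_integral (lebN N) {z \<in> pos_orthant N. s z \<le> r} (\<lambda>z. ennreal (\<phi> (s z)))"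
      using qh by (intro nn_integral_cong) (auto simp: indicator_def)
    also have "\<dots> = B (r / b)"
      unfolding \<phi>_def s_def B_def using N ab c by (rule predictive_integral_eq_b2)
    finally show ?thesis .
  qed
  have Bc0: "B c0 = ennreal (1 - lam)"
  proof -
    \<comment> \<open>A Bochner integral without integrability has the default value 0, whereas here
      the value 1 - \<open>lam\<close> is positive.\<close>
    have "set_integrable lborel {0..c0} (b2_density N a)"
      using c0(2) \<open>lam < 1\<close> not_integrable_integral_eq
      unfolding set_integrable_def set_lebesgue_integral_def a_def by fastforce
    then have "(\<integral>\<^sup>+w. ennreal (indicator {0..c0} w *\<^sub>R b2_density N a w) \<partial>lborel) = ennreal (1 - lam)"
      using c0(2) ab N b2_density_nonneg[of a "real N"] unfolding set_integrable_def set_lebesgue_integral_def a_def[symmetric]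
      by (subst nn_integral_eq_integral) auto
    moreover have "B c0 = (\<integral>\<^sup>+w. ennreal (indicator {0..c0} w *\<^sub>R b2_density N a w) \<partial>lborel)"
      unfolding B_def by (intro nn_integral_cong) (auto simp: indicator_def)
    ultimately show ?thesis by simp
  qed
  have B_less: "B r < B r'" if "0 \<le> r" "r < r'" "B r \<noteq> \<infinity>" for r r'
    using that ab N b2_integral_strict_mono[of a "real N" r r'] by (simp add: B_def)
  have I_mono: "?I A \<le> ?I A'" if "A \<subseteq> A'" for A A'
    using that by (intro nn_integral_mono mult_left_mono) (auto simp: indicator_def)
  let ?T = "{z \<in> pos_orthant N. s z \<le> c0 * b}"
  \<comment> \<open>The witness is the predictive density on the boundary of the claimed region; as
    \<phi> is strictly decreasing, its superlevel set is that region.\<close>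
  have ex: "?I (hpd_set N qh (\<phi> (c0 * b))) = ennreal (1 - lam)"
  proof -
    have "\<phi> (c0 * b) \<le> \<phi> (s z) \<longleftrightarrow> s z \<le> c0 * b" if "z \<in> pos_orthant N" for z
      using \<phi>_less[of "s z" "c0 * b"] \<phi>_less[of "c0 * b" "s z"] s_pos[OF that] c0(1) ab
      by (cases "s z" "c0 * b" rule: linorder_cases) auto
    then have "hpd_set N qh (\<phi> (c0 * b)) = ?T"
      using qh by (auto simp: hpd_set_def)
    then show ?thesis
      using int_le[of "c0 * b"] ab Bc0 by simp
  qed
  have un: "hpd_set N qh k = ?T" if k: "?I (hpd_set N qh k) = ennreal (1 - lam)" for k
  proof (intro equalityI subsetI)
    fix z assume z: "z \<in> hpd_set N qh k"
    then have zo: "z \<in> pos_orthant N" and kz: "k \<le> \<phi> (s z)"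
      by (auto simp: hpd_set_def qh)
    show "z \<in> ?T"
    proof (rule ccontr)
      assume "z \<notin> ?T"
      \<comment> \<open>With z the HPD set contains the whole sublevel set of \<open>s\<close>
        through z, whose mass already exceeds 1 - \<open>lam\<close>.\<close>
      then have "c0 < s z / b"
        using zo ab by (simp add: field_simps)
      then have "B c0 < B (s z / b)"
        using c0(1) Bc0 by (intro B_less) auto
      also have "\<dots> = ?I {y \<in> pos_orthant N. s y \<le> s z}"
        by (simp add: int_le)
      also have "\<dots> \<le> ?I (hpd_set N qh k)"
      proof (rule I_mono, rule subsetI)
        fix y assume "y \<in> {y \<in> pos_orthant N. s y \<le> s z}"
        then have y: "y \<in> pos_orthant N" "s y \<le> s z" by auto
        then have "\<phi> (s z) \<le> \<phi> (s y)"
          using \<phi>_less[of "s y" "s z"] s_pos[OF y(1)] by (cases "s y = s z") auto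
        then show "y \<in> hpd_set N qh k"
          using y kz by (auto simp: hpd_set_def qh)
      qed
      finally show False using k Bc0 by simp
    qed
  next
    fix z assume "z \<in> ?T"
    then have zo: "z \<in> pos_orthant N" and sz: "s z \<le> c0 * b" by auto
    show "z \<in> hpd_set N qh k"
    proof (rule ccontr)
      assume "z \<notin> hpd_set N qh k"
      then have "\<phi> (s z) < k"
        using zo by (auto simp: hpd_set_def qh)
      \<comment> \<open>Excluding z alone is not enough when z lies on the boundary, since the
        sublevel set through z then has exactly the right mass. Continuity pushes the bound down to
        some w < \<open>s z\<close>, and the HPD set loses a layer of positive mass.\<close>
      moreover have "isCont \<phi> (s z)"
        unfolding \<phi>_def[abs_def] using s_pos[OF zo] ab by (intro continuous_intros) auto
      ultimately have "eventually (\<lambda>w. \<phi> w < k) (at_left (s z))"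
        by (auto simp: isCont_def intro: order_tendstoD filterlim_mono[OF _ order_refl at_le])
      moreover have "eventually (\<lambda>w. w \<in> {0<..<s z}) (at_left (s z))"
        using s_pos[OF zo] by (rule eventually_at_left_real)
      ultimately have "eventually (\<lambda>w. \<phi> w < k \<and> w \<in> {0<..<s z}) (at_left (s z))"
        by (rule eventually_conj)
      then obtain w where w: "\<phi> w < k" "0 < w" "w < s z"
        using eventually_happens'[OF trivial_limit_at_left_real] by auto
      have "hpd_set N qh k \<subseteq> {y \<in> pos_orthant N. s y \<le> w}"
      proof
        fix y assume "y \<in> hpd_set N qh k"
        then have y: "y \<in> pos_orthant N" "k \<le> \<phi> (s y)"
          by (auto simp: hpd_set_def qh)
        then have "\<not> w < s y"
          using \<phi>_less[of w "s y"] w by auto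
        with y show "y \<in> {y \<in> pos_orthant N. s y \<le> w}" by simp
      qed
      then have "?I (hpd_set N qh k) \<le> B (w / b)"
        unfolding int_le[symmetric] by (rule I_mono)
      moreover have "B (w / b) < B c0"
      proof -
        have wb: "0 \<le> w / b" "w / b < c0"
          using w sz ab by (auto simp: pos_divide_less_eq)
        \<comment> \<open>Plain monotonicity first: it transfers finiteness from
          \<open>B c0\<close>, as required for the strict comparison.\<close>
        then have "B (w / b) \<le> B c0"
          unfolding B_def by (intro nn_integral_mono mult_left_mono) (auto simp: indicator_def)
        then have "B (w / b) \<noteq> \<infinity>"
          using Bc0 by (auto simp: top_unique)
        with wb show ?thesis
          by (intro B_less)
      qed
      ultimately show False using k Bc0 by simp
    qed
  qed
  show ?thesis
    unfolding Let_def qh_def[symmetric] c_def[symmetric] b_def[symmetric] s_def[symmetric]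
  proof (intro conjI exI allI impI)
    show "?I (hpd_set N qh (\<phi> (c0 * b))) = ennreal (1 - lam)"
      by (rule ex)
    show "hpd_set N qh k = ?T" if "?I (hpd_set N qh k) = ennreal (1 - lam)" for k
      using that by (rule un)
  qed
qed

end
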